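(* Let $K\subset\mathbb{R}^2$ be a convex quadrilateral, and let $\boldsymbol{V}_K$ and the degrees of freedom $\Sigma_K=\{\sigma_1,\dots,\sigma_{12}\}$ be as defined in the context. Then: (1) The finite element $(K,\boldsymbol{V}_K,\Sigma_K)$ is well-defined, i.e. $\dim\boldsymbol{V}_K=12$ and, if $\boldsymbol{v}\in\boldsymbol{V}_K$ satisfies $\sigma_j(\boldsymbol{v})=0$ for $j=1,\dots,12$, then $\boldsymbol{v}=\boldsymbol{0}$. (2) For all $\boldsymbol{v}\in\boldsymbol{V}_K$ and $i=1,2,3,4$, $$\frac{1}{|E_i|}\int_{E_i}(\boldsymbol{v}\cdot\boldsymbol{n}_i)\,\xi_i\,\mathrm{d}s=\frac{1}{6}\left(\boldsymbol{v}(V_{i+1})-\boldsymbol{v}(V_{i})\right)\cdot\boldsymbol{n}_i,$$ where $\xi_i\in P_1(E_i)$ is determined by $\xi_i(V_i)=-1$ and $\xi_i(V_{i+1})=1$. (3) $[P_1(K)]^2\subset\boldsymbol{V}_K$.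
   Context: $P_k$ denotes polynomials of degree at most $k$; $\mathbf{curl}\,w=(\partial w/\partial y,-\partial w/\partial x)^T$. Geometry: $K$ has vertices $V_1,V_2,V_3,V_4$ in counterclockwise order, indices modulo 4, $E_i=V_iV_{i+1}$ is the $i$-th edge with length $|E_i|$, midpoint $M_i$, unit normal $\boldsymbol{n}_i$ and unit tangent $\boldsymbol{t}_i$. Let $l_i$, $m_{13}$, $m_{24}$, $l_{13}$, $l_{24}$ be the affine functions of $(x,y)$ vanishing respectively on the lines containing $E_i$, $M_1M_3$, $M_2M_4$, $V_1V_3$, $V_2V_4$, uniquely normalized by $l_1(M_3)=l_2(M_4)=l_3(M_1)=l_4(M_2)=m_{13}(M_2)=m_{24}(M_3)=l_{13}(V_4)=l_{24}(V_3)=1$. Let $\boldsymbol{A}=\frac14\left(V_3-V_4-V_1+V_2,\;V_3+V_4-V_1-V_2\right)$ (columns), $\boldsymbol{d}=\frac14(V_3-V_4+V_1-V_2)$, $(s_1,s_2)^T=\boldsymbol{A}^{-1}\boldsymbol{d}$, and $$\phi_1=(s_2-1)(s_2+1)l_1l_3m_{13}m_{24}-s_1s_2l_1l_3m_{24}^2+s_1l_1l_3m_{24}^2m_{13},$$ $$\phi_2=(s_1-1)(s_1+1)l_2l_4m_{13}m_{24}-s_1s_2l_2l_4m_{13}^2+s_2l_2l_4m_{13}^2m_{24}.$$ Let $W_K^b=\mathrm{span}\{b_0,b_0x,b_0y,b_0l_{13}l_{24}\}$ with $b_0=l_1l_2l_3l_4$. Spaces: $$\boldsymbol{V}_K^-=[P_1(K)]^2\oplus\mathrm{span}\{\mathbf{curl}\,x^3,\mathbf{curl}\,x^2y,\mathbf{curl}\,xy^2,\mathbf{curl}\,y^3,\mathbf{curl}\,\phi_1,\mathbf{curl}\,\phi_2\},\qquad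 \boldsymbol{V}_K^b=\mathbf{curl}\,W_K^b,$$ $$\boldsymbol{V}_K=\left\{\boldsymbol{v}\in \boldsymbol{V}_K^-\oplus \boldsymbol{V}_K^b:\ \frac{1}{|E_{i}|}\int_{E_{i}}\boldsymbol{v}\cdot\boldsymbol{t}_i\,\mathrm{d}s=\frac{1}{2}\left(\boldsymbol{v}(V_i)+\boldsymbol{v}(V_{i+1})\right)\cdot\boldsymbol{t}_i,\ i=1,2,3,4\right\}.$$ Degrees of freedom: $\sigma_j(\boldsymbol{v})=\int_{E_j}\boldsymbol{v}\cdot\boldsymbol{n}_j\,\mathrm{d}s$, $(\sigma_{j+4}(\boldsymbol{v}),\sigma_{j+8}(\boldsymbol{v}))^T=\boldsymbol{v}(V_j)$, $j=1,2,3,4$. *)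

theory Defs
  imports
    "HOL-Analysis.Analysis"
    "HOL-Library.Function_Algebras"
    "HOL-Library.Numeral_Type"
begin

text \<open>Functions with values in a real vector space form a real vector space under the pointwise
  operations; this makes \<^const>\<open>span\<close> and \<^const>\<open>dim\<close> available for spaces of functions.\<close>

instantiation "fun" :: (type, scaleR) scaleR
begin

definition "scaleR c f = (\<lambda>x. c *\<^sub>R f x)"

instance ..

end

instance "fun" :: (type, real_vector) real_vector
  by standard (auto simp: scaleR_fun_def fun_eq_iff algebra_simps)

text \<open>Polynomial functions are taken as functions on the whole plane. A polynomial is determined by
  its values on a set with nonempty interior, so this is the usual identification of $P_k(K)$ with
  $P_k$.\<close>

definition poly_space :: "nat \<Rightarrow> (real^2 \<Rightarrow> real) set" where
  "poly_space k = span {(\<lambda>p. (p$1) ^ a * (p$2) ^ b) | a b. a + b \<le> k}"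

lemma poly_space_1: "poly_space 1 = {(\<lambda>p. a + b * p$1 + c * p$2) | a b c. True}"
proof -
  have eq: "{(\<lambda>p::real^2. (p$1) ^ a * (p$2) ^ b) | a b. a + b \<le> 1}
      = {(\<lambda>p. 1), (\<lambda>p. p$1), (\<lambda>p. p$2)}" (is "?L = ?R")
  proof
    show "?L \<subseteq> ?R"
    proof
      fix f assume "f \<in> ?L"
      then obtain a b where f: "f = (\<lambda>p. (p$1) ^ a * (p$2) ^ b)" and "a + b \<le> 1" by blast
      then have "a = 0 \<and> b = 0 \<or> a = 1 \<and> b = 0 \<or> a = 0 \<and> b = 1" by arith
      then show "f \<in> ?R" unfolding f by auto
    qed
    show "?R \<subseteq> ?L"
    proof -
      have "(\<lambda>p::real^2. 1::real) \<in> ?L"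
        by (rule CollectI, rule exI[of _ 0], rule exI[of _ 0]) simp
      moreover have "(\<lambda>p::real^2. p$1) \<in> ?L"
        by (rule CollectI, rule exI[of _ 1], rule exI[of _ 0]) simp
      moreover have "(\<lambda>p::real^2. p$2) \<in> ?L"
        by (rule CollectI, rule exI[of _ 0], rule exI[of _ 1]) simp
      ultimately show ?thesis by simp
    qed
  qed
  show ?thesis
    unfolding poly_space_def eq span_insert span_empty
    by (simp add: set_eq_iff scaleR_fun_def fun_eq_iff algebra_simps)
qed

definition vec_poly_space :: "nat \<Rightarrow> (real^2 \<Rightarrow> real^2) set" where
  "vec_poly_space k = {v. (\<lambda>p. v p $ 1) \<in> poly_space k \<and> (\<lambda>p. v p $ 2) \<in> poly_space k}"

definition partial_deriv :: "2 \<Rightarrow> (real^2 \<Rightarrow> real) \<Rightarrow> real^2 \<Rightarrow> real" where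
  "partial_deriv k w p = deriv (\<lambda>h. w (p + h *\<^sub>R axis k 1)) 0"

definition curl :: "(real^2 \<Rightarrow> real) \<Rightarrow> real^2 \<Rightarrow> real^2" where
  "curl w p = vector [partial_deriv 2 w p, - partial_deriv 1 w p]"

definition cross2 :: "real^2 \<Rightarrow> real^2 \<Rightarrow> real" where
  "cross2 u v = u$1 * v$2 - u$2 * v$1"

text \<open>Indices live in the type \<^typ>\<open>4\<close> of integers modulo 4 (where \<open>4 = 0\<close>), so that \<open>V (i + 1)\<close> is the
  cyclic successor of \<open>V i\<close>. The points are the vertices of a (nondegenerate) convex quadrilateral listed counterclockwise:
  both vertices not on an edge lie strictly to the left of the line through that edge.\<close>

definition convex_quadrilateral :: "(4 \<Rightarrow> real^2) \<Rightarrow> bool" where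
  "convex_quadrilateral V \<longleftrightarrow>
     (\<forall>i j. j \<noteq> i \<longrightarrow> j \<noteq> i + 1 \<longrightarrow> cross2 (V (i + 1) - V i) (V j - V i) > 0)"

definition edge_mid :: "(4 \<Rightarrow> real^2) \<Rightarrow> 4 \<Rightarrow> real^2" where
  "edge_mid V i = midpoint (V i) (V (i + 1))"

definition edge_length :: "(4 \<Rightarrow> real^2) \<Rightarrow> 4 \<Rightarrow> real" where
  "edge_length V i = dist (V i) (V (i + 1))"

text \<open>No orientation is prescribed: each of the two unit normals (tangents) of an edge is allowed,
  independently for every edge.\<close>

definition unit_tangents :: "(4 \<Rightarrow> real^2) \<Rightarrow> (4 \<Rightarrow> real^2) \<Rightarrow> bool" where
  "unit_tangents V t \<longleftrightarrow> (\<forall>i. norm (t i) = 1 \<and> (\<exists>c. t i = c *\<^sub>R (V (i + 1) - V i)))"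

definition unit_normals :: "(4 \<Rightarrow> real^2) \<Rightarrow> (4 \<Rightarrow> real^2) \<Rightarrow> bool" where
  "unit_normals V n \<longleftrightarrow> (\<forall>i. norm (n i) = 1 \<and> n i \<bullet> (V (i + 1) - V i) = 0)"

text \<open>Arc-length integral over $E_i$; the parametrization \<^term>\<open>linepath (V i) (V (i + 1))\<close> has
  constant speed $|E_i|$.\<close>

definition edge_integral :: "(4 \<Rightarrow> real^2) \<Rightarrow> 4 \<Rightarrow> (real^2 \<Rightarrow> real) \<Rightarrow> real" where
  "edge_integral V i g =
     edge_length V i * integral {0..1} (\<lambda>s. g (linepath (V i) (V (i + 1)) s))"

definition line_fun :: "real^2 \<Rightarrow> real^2 \<Rightarrow> real^2 \<Rightarrow> real^2 \<Rightarrow> real" where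
  "line_fun P Q R =
     (THE f. f \<in> poly_space 1 \<and> (\<forall>p \<in> affine hull {P, Q}. f p = 0) \<and> f R = 1)"

lemma line_fun_unique:
  assumes "cross2 (Q - P) (R - P) \<noteq> 0"
  shows "\<exists>!f. f \<in> poly_space 1 \<and> (\<forall>p \<in> affine hull {P, Q}. f p = 0) \<and> f R = 1"
proof -
  define D where "D = cross2 (Q - P) (R - P)"
  let ?g = "\<lambda>p. cross2 (Q - P) (p - P) / D"
  show ?thesis
  proof (rule ex1I[of _ ?g])
    have "?g = (\<lambda>p. ((Q$2 - P$2) * P$1 - (Q$1 - P$1) * P$2) / D
               + (- (Q$2 - P$2) / D) * p$1 + ((Q$1 - P$1) / D) * p$2)"
      by (simp add: cross2_def fun_eq_iff diff_divide_distrib add_divide_distrib algebra_simps)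
    then have "?g \<in> poly_space 1" unfolding poly_space_1 by blast
    moreover have "?g p = 0" if p: "p \<in> affine hull {P, Q}" for p
    proof -
      obtain u v where "p = u *\<^sub>R P + v *\<^sub>R Q" "u + v = 1" using p unfolding affine_hull_2 by blast
      then have "p - P = v *\<^sub>R (Q - P)" by (simp add: algebra_simps flip: scaleR_add_left)
      then show ?thesis by (simp add: cross2_def)
    qed
    moreover have "?g R = 1" using assms by (simp add: D_def)
    ultimately show "?g \<in> poly_space 1 \<and> (\<forall>p \<in> affine hull {P, Q}. ?g p = 0) \<and> ?g R = 1" by blast
  next
    fix f assume f: "f \<in> poly_space 1 \<and> (\<forall>p \<in> affine hull {P, Q}. f p = 0) \<and> f R = 1"
    then obtain a b c where fe: "f = (\<lambda>p. a + b * p$1 + c * p$2)" unfolding poly_space_1 by blast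
    have P: "a + b * P$1 + c * P$2 = 0" and Q: "a + b * Q$1 + c * Q$2 = 0"
      using f by (auto simp: fe hull_inc)
    have R: "a + b * R$1 + c * R$2 = 1" using f by (simp add: fe)
    have D0: "D \<noteq> 0" using assms by (simp add: D_def)
    have "f p * D = cross2 (Q - P) (p - P)" for p
      using P Q R unfolding fe D_def cross2_def vector_minus_component by algebra
    then show "f = ?g" using D0 by (simp add: fun_eq_iff field_simps)
  qed
qed

definition l_edge :: "(4 \<Rightarrow> real^2) \<Rightarrow> 4 \<Rightarrow> real^2 \<Rightarrow> real" where
  "l_edge V i = line_fun (V i) (V (i + 1)) (edge_mid V (i + 2))"

definition m13 :: "(4 \<Rightarrow> real^2) \<Rightarrow> real^2 \<Rightarrow> real" where
  "m13 V = line_fun (edge_mid V 1) (edge_mid V 3) (edge_mid V 2)"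

definition m24 :: "(4 \<Rightarrow> real^2) \<Rightarrow> real^2 \<Rightarrow> real" where
  "m24 V = line_fun (edge_mid V 2) (edge_mid V 4) (edge_mid V 3)"

definition l13 :: "(4 \<Rightarrow> real^2) \<Rightarrow> real^2 \<Rightarrow> real" where
  "l13 V = line_fun (V 1) (V 3) (V 4)"

definition l24 :: "(4 \<Rightarrow> real^2) \<Rightarrow> real^2 \<Rightarrow> real" where
  "l24 V = line_fun (V 2) (V 4) (V 3)"

definition matA :: "(4 \<Rightarrow> real^2) \<Rightarrow> real^2^2" where
  "matA V = transpose (vector [(1/4) *\<^sub>R (V 3 - V 4 - V 1 + V 2),
                               (1/4) *\<^sub>R (V 3 + V 4 - V 1 - V 2)])"

definition vecd :: "(4 \<Rightarrow> real^2) \<Rightarrow> real^2" where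
  "vecd V = (1/4) *\<^sub>R (V 3 - V 4 + V 1 - V 2)"

definition svec :: "(4 \<Rightarrow> real^2) \<Rightarrow> real^2" where
  "svec V = matrix_inv (matA V) *v vecd V"

definition phi1 :: "(4 \<Rightarrow> real^2) \<Rightarrow> real^2 \<Rightarrow> real" where
  "phi1 V p = (let s1 = svec V $ 1; s2 = svec V $ 2 in
       (s2 - 1) * (s2 + 1) * l_edge V 1 p * l_edge V 3 p * m13 V p * m24 V p
     - s1 * s2 * l_edge V 1 p * l_edge V 3 p * (m24 V p)\<^sup>2
     + s1 * l_edge V 1 p * l_edge V 3 p * (m24 V p)\<^sup>2 * m13 V p)"

definition phi2 :: "(4 \<Rightarrow> real^2) \<Rightarrow> real^2 \<Rightarrow> real" where
  "phi2 V p = (let s1 = svec V $ 1; s2 = svec V $ 2 in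
       (s1 - 1) * (s1 + 1) * l_edge V 2 p * l_edge V 4 p * m13 V p * m24 V p
     - s1 * s2 * l_edge V 2 p * l_edge V 4 p * (m13 V p)\<^sup>2
     + s2 * l_edge V 2 p * l_edge V 4 p * (m13 V p)\<^sup>2 * m24 V p)"

definition b0 :: "(4 \<Rightarrow> real^2) \<Rightarrow> real^2 \<Rightarrow> real" where
  "b0 V p = l_edge V 1 p * l_edge V 2 p * l_edge V 3 p * l_edge V 4 p"

definition Wb :: "(4 \<Rightarrow> real^2) \<Rightarrow> (real^2 \<Rightarrow> real) set" where
  "Wb V = span {b0 V, (\<lambda>p. b0 V p * p$1), (\<lambda>p. b0 V p * p$2),
                (\<lambda>p. b0 V p * l13 V p * l24 V p)}"

text \<open>In the next definitions the direct sums are written as sums of subspaces, which are the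
  same sets.\<close>

definition Vminus :: "(4 \<Rightarrow> real^2) \<Rightarrow> (real^2 \<Rightarrow> real^2) set" where
  "Vminus V = {u + w | u w. u \<in> vec_poly_space 1 \<and>
     w \<in> span {curl (\<lambda>p. (p$1)^3), curl (\<lambda>p. (p$1)\<^sup>2 * p$2), curl (\<lambda>p. p$1 * (p$2)\<^sup>2),
               curl (\<lambda>p. (p$2)^3), curl (phi1 V), curl (phi2 V)}}"

definition Vb :: "(4 \<Rightarrow> real^2) \<Rightarrow> (real^2 \<Rightarrow> real^2) set" where
  "Vb V = curl ` Wb V"

definition VK :: "(4 \<Rightarrow> real^2) \<Rightarrow> (4 \<Rightarrow> real^2) \<Rightarrow> (real^2 \<Rightarrow> real^2) set" where
  "VK V t = {v \<in> {u + w | u w. u \<in> Vminus V \<and> w \<in> Vb V}.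
     \<forall>i. 1 / edge_length V i * edge_integral V i (\<lambda>p. v p \<bullet> t i)
         = 1/2 * ((v (V i) + v (V (i + 1))) \<bullet> t i)}"

definition dof ::
  "(4 \<Rightarrow> real^2) \<Rightarrow> (4 \<Rightarrow> real^2) \<Rightarrow> nat \<Rightarrow> (real^2 \<Rightarrow> real^2) \<Rightarrow> real" where
  "dof V n j v =
     (if j \<le> 4 then edge_integral V (of_nat j) (\<lambda>p. v p \<bullet> n (of_nat j))
      else if j \<le> 8 then v (V (of_nat (j - 4))) $ 1
      else v (V (of_nat (j - 8))) $ 2)"

end

(*
An element of the sum space is v = e p + curl w with a constant e and a stream function w, so along
an edge the normal component of v is a constant plus the tangential derivative of w.  Centred at
the midpoint of the edge, w has the form (even quadratic) + (odd quintic): the bubbles vanish there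
and the combinations phi_1, phi_2 have odd traces.  Hence the normal component is linear plus even,
and the moment identity (2) holds because it holds for linear functions.

Unisolvence.  Vanishing fluxes give e = 0 and equal values of w at the vertices.  Together with
the vanishing gradient at the vertices this makes the cubic part of w vanish at all vertices and
edge midpoints, so it equals a m_24 l_1 l_3 + b m_13 l_2 l_4.  Comparing with phi_1 on the edges 2
and 4, and with phi_2 on the edges 1 and 3, the coefficients are multiplied by
1 - s_1^2 - s_2^2 > 0 and hence vanish.  For the remaining bubble b_0 g, the tangential condition
on E_i says that the affine part of g takes a prescribed multiple of the coefficient of l_13 l_24
at a point near the middle of E_i.  The multiples alternate in sign around the quadrilateral, which
is impossible for a nonzero affine function.  The 12 + 4 functionals are thus independent on the
16-parameter space, and the kernel of the last four has dimension 12.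
*)

theory Submission
  imports Defs
begin

section \<open>Kernels of unisolvent functionals and the curl\<close>

text \<open>The joint map \<open>H\<close> is injective between spaces of equal dimension, hence
  bijective, and carries the parameters with \<open>G (\<Phi> c) = 0\<close> onto the first factor.
  Linearity is asked only along \<open>\<Phi>\<close>, because edge integrals are not additive on
  arbitrary functions.\<close>

lemma dim_kernel_unisolvent:
  fixes \<Phi> :: "'e::euclidean_space \<Rightarrow> 'v::real_vector"
    and F :: "'v \<Rightarrow> 'a::euclidean_space" and G :: "'v \<Rightarrow> 'b::euclidean_space"
  assumes lin: "linear \<Phi>" "linear (\<lambda>c. F (\<Phi> c))" "linear (\<lambda>c. G (\<Phi> c))"
    and unisolvent: "\<And>c. F (\<Phi> c) = 0 \<Longrightarrow> G (\<Phi> c) = 0 \<Longrightarrow> c = 0"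
    and DIM: "DIM('e) = DIM('a) + DIM('b)"
  shows "dim {v \<in> range \<Phi>. G v = 0} = DIM('a)"
proof -
  define H where "H = (\<lambda>c. (F (\<Phi> c), G (\<Phi> c)))"
  have linH: "linear H"
    unfolding H_def
    by (rule linearI)
       (simp_all add: linear_add[OF lin(2)] linear_add[OF lin(3)] linear_cmul[OF lin(2)]
           linear_cmul[OF lin(3)])
  have injH: "inj H"
    unfolding linear_injective_0[OF linH] by (simp add: H_def unisolvent zero_prod_def)
  define T where "T = {c. G (\<Phi> c) = 0}"
  have T: "subspace T"
    unfolding T_def by (rule linear_subspace_kernel[OF lin(3)])
  have "dim (range H) = DIM('a \<times> 'b)"
    using eucl.dim_image_eq[OF linH, of UNIV] injH DIM by simp
  then have "span (range H) = UNIV"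
    by (metis dim_eq_full)
  then have "range H = UNIV"
    using linear_subspace_image[OF linH subspace_UNIV] by (metis span_eq_iff)
  then have HT: "H ` T = UNIV \<times> {0}"
    unfolding T_def H_def by (auto simp: image_iff set_eq_iff) (metis UNIV_I rangeE prod.inject)
  have inj\<Phi>: "inj \<Phi>"
    using injH unfolding inj_def H_def by metis
  have "{v \<in> range \<Phi>. G v = 0} = \<Phi> ` T"
    by (auto simp: T_def)
  then have "dim {v \<in> range \<Phi>. G v = 0} = dim T"
    using eucl.dim_image_eq[OF lin(1), of T] inj\<Phi> inj_on_subset by (metis subset_UNIV)
  also have "\<dots> = dim (UNIV \<times> {0} :: ('a \<times> 'b) set)"
    using eucl.dim_image_eq[OF linH, of T] injH inj_on_subset HT by (metis subset_UNIV)
  also have "\<dots> = DIM('a)"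
    by (simp add: dim_Times)
  finally show ?thesis .
qed

section \<open>Derivatives and curls of polynomial functions\<close>

lemma partial_deriv_eq:
  assumes "(w has_derivative D) (at p)"
  shows "partial_deriv k w p = D (axis k 1)"
proof -
  interpret D: bounded_linear D using assms by (rule has_derivative_bounded_linear)
  have "((\<lambda>h. w (p + h *\<^sub>R axis k 1)) has_derivative (\<lambda>h. D (h *\<^sub>R axis k 1))) (at 0)"
    by (rule has_derivative_compose[where g = w and g' = D])
       (auto intro!: derivative_eq_intros simp: assms)
  then have "((\<lambda>h. w (p + h *\<^sub>R axis k 1)) has_field_derivative D (axis k 1)) (at 0)"
    by (simp add: has_field_derivative_def D.scaleR mult_commute_abs)
  then show ?thesis unfolding partial_deriv_def by (rule DERIV_imp_deriv)
qed

lemma has_derivative_partial_deriv: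
  assumes "w differentiable (at p)"
  shows "(w has_derivative (\<lambda>h. h$1 * partial_deriv 1 w p + h$2 * partial_deriv 2 w p)) (at p)"
proof -
  obtain D where D: "(w has_derivative D) (at p)" using assms unfolding differentiable_def by blast
  interpret D: bounded_linear D using D by (rule has_derivative_bounded_linear)
  have "D h = h$1 * partial_deriv 1 w p + h$2 * partial_deriv 2 w p" for h
  proof -
    have "h = h$1 *\<^sub>R axis 1 1 + h$2 *\<^sub>R axis 2 1"
      by (simp add: vec_eq_iff forall_2 axis_def)
    then have "D h = D (h$1 *\<^sub>R axis 1 1 + h$2 *\<^sub>R axis 2 1)" by simp
    then show ?thesis by (simp add: D.add D.scaleR partial_deriv_eq[OF D])
  qed
  then have "D = (\<lambda>h. h$1 * partial_deriv 1 w p + h$2 * partial_deriv 2 w p)" by blast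
  with D show ?thesis by simp
qed

lemma differentiable_real_polynomial_function:
  "real_polynomial_function w \<Longrightarrow> w differentiable (at p)"
proof (induction rule: real_polynomial_function.induct)
  case (linear f)
  then show ?case by (rule bounded_linear_imp_differentiable)
next
  case (const c)
  show ?case by (rule differentiable_const)
next
  case (add u w)
  from add.IH show ?case by (rule differentiable_add)
next
  case (mult u w)
  from mult.IH show ?case by (rule differentiable_mult)
qed

lemma real_polynomial_function_vec_nth [intro]: "real_polynomial_function (\<lambda>p. p $ k)"
  by (intro real_polynomial_function.intros(1) bounded_linear_vec_nth)

lemma partial_deriv_const: "partial_deriv k (\<lambda>_. c) p = 0"
  using partial_deriv_eq[OF has_derivative_const] .

lemma partial_deriv_add:
  assumes "real_polynomial_function u" "real_polynomial_function w"
  shows "partial_deriv k (\<lambda>p. u p + w p) p = partial_deriv k u p + partial_deriv k w p"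
proof -
  obtain Du where D1: "(u has_derivative Du) (at p)"
    using differentiable_real_polynomial_function[OF assms(1), of p] unfolding differentiable_def
        by blast
  obtain Dw where D2: "(w has_derivative Dw) (at p)"
    using differentiable_real_polynomial_function[OF assms(2), of p] unfolding differentiable_def
        by blast
  note D = D1 D2
  show ?thesis
    using partial_deriv_eq[OF has_derivative_add[OF D], of k] partial_deriv_eq[OF D(1), of k]
      partial_deriv_eq[OF D(2), of k] by argo
qed

lemma partial_deriv_mult:
  assumes "real_polynomial_function u" "real_polynomial_function w"
  shows "partial_deriv k (\<lambda>p. u p * w p) p = u p * partial_deriv k w p + partial_deriv k u p * w p"
proof -
  obtain Du where D1: "(u has_derivative Du) (at p)"
    using differentiable_real_polynomial_function[OF assms(1), of p] unfolding differentiable_def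
        by blast
  obtain Dw where D2: "(w has_derivative Dw) (at p)"
    using differentiable_real_polynomial_function[OF assms(2), of p] unfolding differentiable_def
        by blast
  note D = D1 D2
  show ?thesis
    using partial_deriv_eq[OF has_derivative_mult[OF D], of k] partial_deriv_eq[OF D(1), of k]
      partial_deriv_eq[OF D(2), of k] by (simp only:)
qed

text \<open>Induction over the construction of a polynomial function suffices; the result makes
  velocities integrable along edges.\<close>

lemma continuous_on_partial_deriv:
  assumes "real_polynomial_function w"
  shows "continuous_on S (partial_deriv k w)"
  using assms
proof (induction rule: real_polynomial_function.induct)
  case (linear f)
  then have "partial_deriv k f = (\<lambda>p. f (axis k 1))"
    using partial_deriv_eq[OF bounded_linear_imp_has_derivative[OF linear]] by blast
  then show ?case by simp
next
  case (const c)
  then show ?case by (simp add: partial_deriv_const)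
next
  case (add u w)
  then have "partial_deriv k (\<lambda>p. u p + w p) = (\<lambda>p. partial_deriv k u p + partial_deriv k w p)"
    by (simp add: partial_deriv_add fun_eq_iff)
  with add show ?case by (simp add: continuous_on_add)
next
  case (mult u w)
  then have eq: "partial_deriv k (\<lambda>p. u p * w p) =
      (\<lambda>p. u p * partial_deriv k w p + partial_deriv k u p * w p)"
    by (simp add: partial_deriv_mult fun_eq_iff)
  have "continuous_on S u" "continuous_on S w"
    using mult.hyps by (auto intro: continuous_on_polymonial_function simp:
        real_polynomial_function_eq)
  with mult show ?case unfolding eq by (intro continuous_intros)
qed

lemma curl_nth [simp]: "curl w p $ 1 = partial_deriv 2 w p" "curl w p $ 2 = - partial_deriv 1 w p"
  by (simp_all add: curl_def)

lemma continuous_on_curl: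
  assumes "real_polynomial_function w"
  shows "continuous_on S (curl w)"
proof -
  have "curl w = (\<lambda>p. \<chi> i. if i = 1 then partial_deriv 2 w p else - partial_deriv 1 w p)"
    by (simp add: fun_eq_iff vec_eq_iff forall_2)
  moreover have "continuous_on S (\<lambda>p. if i = 1 then partial_deriv 2 w p else
      - partial_deriv 1 w p)" for i :: 2
    using assms by (cases "i = 1") (auto intro!: continuous_on_partial_deriv continuous_on_minus)
  ultimately show ?thesis
    by (simp add: continuous_on_vec_lambda)
qed

lemma curl_const: "curl (\<lambda>_. c) p = 0"
  by (simp add: vec_eq_iff forall_2 partial_deriv_const)

lemma curl_add:
  assumes "real_polynomial_function u" "real_polynomial_function w"
  shows "curl (\<lambda>p. u p + w p) p = curl u p + curl w p"
  using assms by (simp add: vec_eq_iff forall_2 partial_deriv_add)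

lemma curl_mult:
  assumes "real_polynomial_function u" "real_polynomial_function w"
  shows "curl (\<lambda>p. u p * w p) p = u p *\<^sub>R curl w p + w p *\<^sub>R curl u p"
  using assms by (simp add: vec_eq_iff forall_2 partial_deriv_mult algebra_simps)

lemma curl_cmult:
  assumes "real_polynomial_function w"
  shows "curl (\<lambda>p. c * w p) p = c *\<^sub>R curl w p"
  using curl_mult[OF real_polynomial_function.intros(2) assms] by (simp add: curl_const)

text \<open>The curl is the gradient turned by a right angle, so the cross product with it returns
  the directional derivative.\<close>

lemma has_derivative_curl:
  assumes "real_polynomial_function w"
  shows "(w has_derivative (\<lambda>h. cross2 (curl w p) h)) (at p)"
  using has_derivative_partial_deriv[OF differentiable_real_polynomial_function[OF assms], of p]
  by (rule has_derivative_eq_rhs) (simp add: cross2_def fun_eq_iff mult.commute)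

text \<open>The cross product with \<open>Q - P\<close> is a normal component up to scale, so the
  normal trace of a curl on a segment is the derivative of the trace of its stream function.\<close>

lemma has_derivative_along_line:
  assumes "real_polynomial_function w"
  shows "((\<lambda>s. w (linepath P Q s)) has_real_derivative cross2 (curl w (linepath P Q s)) (Q
      - P)) (at s)"
proof -
  have "((\<lambda>s. linepath P Q s) has_derivative (\<lambda>h. h *\<^sub>R (Q - P))) (at s)"
    unfolding linepath_def by (auto intro!: derivative_eq_intros simp: algebra_simps)
  from has_derivative_compose[OF this has_derivative_curl[OF assms]]
  have "((\<lambda>s. w (linepath P Q s)) has_derivative
     (\<lambda>h. cross2 (curl w (linepath P Q s)) (h *\<^sub>R (Q - P)))) (at s)" .
  then show ?thesis
    unfolding has_field_derivative_def
    by (rule has_derivative_eq_rhs) (simp add: cross2_def algebra_simps fun_eq_iff)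
qed

section \<open>Stream functions\<close>

text \<open>A quotient of signed areas meets all the conditions; it replaces the definite
  description in all later computations.\<close>

lemma line_fun_eq:
  assumes "cross2 (Q - P) (R - P) \<noteq> 0"
  shows "line_fun P Q R = (\<lambda>p. cross2 (Q - P) (p - P) / cross2 (Q - P) (R - P))"
proof -
  let ?g = "\<lambda>p. cross2 (Q - P) (p - P) / cross2 (Q - P) (R - P)"
  have "?g = (\<lambda>p. ((Q$2 - P$2) * P$1 - (Q$1 - P$1) * P$2) / cross2 (Q - P) (R - P)
             + (- (Q$2 - P$2) / cross2 (Q - P) (R - P)) * p$1 + ((Q$1 - P$1) / cross2 (Q - P) (R
                 - P)) * p$2)"
    by (simp add: cross2_def fun_eq_iff diff_divide_distrib add_divide_distrib algebra_simps)
  then have "?g \<in> poly_space 1" unfolding poly_space_1 by blast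
  moreover have "?g p = 0" if p: "p \<in> affine hull {P, Q}" for p
  proof -
    obtain u v where "p = u *\<^sub>R P + v *\<^sub>R Q" "u + v = 1" using p unfolding affine_hull_2 by blast
    then have "p - P = v *\<^sub>R (Q - P)" by (simp add: algebra_simps flip: scaleR_add_left)
    then show ?thesis by (simp add: cross2_def)
  qed
  moreover have "?g R = 1" using assms by simp
  ultimately show ?thesis
    unfolding line_fun_def by (intro the1_equality line_fun_unique assms) blast
qed

lemma span_insert4:
  "x \<in> span {a, b, c, d} \<longleftrightarrow> (\<exists>k1 k2 k3 k4. x = k1 *\<^sub>R a + k2 *\<^sub>R b + k3 *\<^sub>R c + k4 *\<^sub>R d)"
  by (simp add: span_insert algebra_simps)

lemma span_insert6:
  "x \<in> span {a, b, c, d, e, f} \<longleftrightarrow>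
    (\<exists>k1 k2 k3 k4 k5 k6. x = k1 *\<^sub>R a + k2 *\<^sub>R b + k3 *\<^sub>R c + k4 *\<^sub>R d + k5 *\<^sub>R e + k6 *\<^sub>R f)"
proof -
  have "x \<in> span {a, b, c, d, e, f} \<longleftrightarrow> (\<exists>k1 k2 k3 k4 k5 k6. x - k1 *\<^sub>R a - k2 *\<^sub>R b - k3 *\<^sub>R c
      - k4 *\<^sub>R d - k5 *\<^sub>R e - k6 *\<^sub>R f = 0)"
    by (simp only: span_breakdown_eq span_empty singleton_iff)
  also have "\<dots> \<longleftrightarrow> (\<exists>k1 k2 k3 k4 k5 k6. x = k1 *\<^sub>R a + k2 *\<^sub>R b + k3 *\<^sub>R c + k4 *\<^sub>R d + k5 *\<^sub>R e
      + k6 *\<^sub>R f)"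
    by (simp only: diff_diff_eq right_minus_eq)
  finally show ?thesis .
qed

text \<open>The sixteen coefficients of \<open>V\<^sub>K\<^sup>- \<oplus> V\<^sub>K\<^sup>b\<close> form a \<open>4 \<times> 4\<close> array. Since
  \<open>[P\<^sub>1]\<^sup>2\<close> is the sum of \<open>span {p \<mapsto> p}\<close> and the curls of the quadratics, entry \<open>(1,1)\<close> carries the
  divergence of the field and all other entries belong to a stream function.\<close>

definition stream :: "(4 \<Rightarrow> real^2) \<Rightarrow> real^4^4 \<Rightarrow> real^2 \<Rightarrow> real" where
  "stream V c p =
     c$1$2 * p$1 + c$1$3 * p$2 + c$1$4 * (p$1 * p$2) + c$2$1 * (p$1)\<^sup>2 + c$2$2 * (p$2)\<^sup>2
   + (c$2$3 * phi1 V p + c$2$4 * phi2 V p)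
   + (c$3$1 * (p$1)^3 + c$3$2 * ((p$1)\<^sup>2 * p$2) + c$3$3 * (p$1 * (p$2)\<^sup>2) + c$3$4 * (p$2)^3)
   + (c$4$1 * b0 V p + c$4$2 * (b0 V p * p$1) + c$4$3 * (b0 V p * p$2)
      + c$4$4 * (b0 V p * l13 V p * l24 V p))"

definition velocity :: "(4 \<Rightarrow> real^2) \<Rightarrow> real^4^4 \<Rightarrow> real^2 \<Rightarrow> real^2" where
  "velocity V c p = c$1$1 *\<^sub>R p + curl (stream V c) p"

text \<open>These are exactly the divergence-free affine fields, so together with the position field
  they account for \<open>vec_poly_space 1\<close>.\<close>

lemma curl_quadratic:
  fixes k1 k2 k3 k4 k5 :: real
  shows "curl (\<lambda>p. k1 * p$1 + k2 * p$2 + k3 * (p$1 * p$2) + k4 * (p$1)\<^sup>2 + k5 * (p$2)\<^sup>2) p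
     = vector [k2 + k3 * p$1 + 2 * k5 * p$2, - (k1 + k3 * p$2 + 2 * k4 * p$1)]"
proof -
  have D: "((\<lambda>p. k1 * p$1 + k2 * p$2 + k3 * (p$1 * p$2) + k4 * (p$1)\<^sup>2
      + k5 * (p$2)\<^sup>2) has_derivative
    (\<lambda>h. (k1 + k3 * p$2 + 2 * k4 * p$1) * h$1 + (k2 + k3 * p$1 + 2 * k5 * p$2) * h$2)) (at p)"
    for p :: "real^2"
    by (auto intro!: derivative_eq_intros bounded_linear.has_derivative[OF bounded_linear_vec_nth]
        simp: algebra_simps)
  show ?thesis
    by (simp add: vec_eq_iff forall_2 partial_deriv_eq[OF D] axis_def)
qed

lemma stream_linear:
  "stream V (c + d) p = stream V c p + stream V d p"
  "stream V (k *\<^sub>R c) p = k * stream V c p"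
  by (simp_all add: stream_def algebra_simps)

section \<open>Reference coordinates\<close>

lemma four_arith: "(4::4) + 1 = 1" "(1::4) + 1 = 2" "(2::4) + 1 = 3" "(3::4) + 1 = 4"
   "(1::4) + 2 = 3" "(2::4) + 2 = 4" "(3::4) + 2 = 1" "(4::4) + 2 = 2"
  by simp_all

locale convex_quad =
  fixes V :: "4 \<Rightarrow> real^2"
  assumes convex: "convex_quadrilateral V"
begin

definition "ctr = (1/4) *\<^sub>R (V 1 + V 2 + V 3 + V 4)"
text \<open>\<open>a1\<close> and \<open>a2\<close> are the columns of \<open>matA V\<close>: the
  vectors from \<open>ctr\<close> to the midpoints of edges 2 and 3.\<close>

definition "a1 = (1/4) *\<^sub>R (V 3 - V 4 - V 1 + V 2)"
definition "a2 = (1/4) *\<^sub>R (V 3 + V 4 - V 1 - V 2)"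
abbreviation "s1 \<equiv> svec V $ 1"
abbreviation "s2 \<equiv> svec V $ 2"
text \<open>Affine coordinates in which the edge midpoints are \<open>(0, -1)\<close>, \<open>(1, 0)\<close>, \<open>(0, 1)\<close>, \<open>(-1, 0)\<close>
    and
  \<open>m\<^sub>1\<^sub>3\<close>, \<open>m\<^sub>2\<^sub>4\<close> are the coordinate functions.\<close>

definition "ref X Y = ctr + X *\<^sub>R a1 + Y *\<^sub>R a2"

lemma turns:
  "cross2 (V 2 - V 1) (V 3 - V 1) > 0" "cross2 (V 2 - V 1) (V 4 - V 1) > 0"
  "cross2 (V 3 - V 2) (V 4 - V 2) > 0" "cross2 (V 3 - V 2) (V 1 - V 2) > 0"
  "cross2 (V 4 - V 3) (V 1 - V 3) > 0" "cross2 (V 4 - V 3) (V 2 - V 3) > 0"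
  "cross2 (V 1 - V 4) (V 2 - V 4) > 0" "cross2 (V 1 - V 4) (V 3 - V 4) > 0"
  using convex unfolding convex_quadrilateral_def forall_4 four_arith by simp_all

text \<open>Twice the area of the quadrilateral is eight times this determinant, and cutting along
  the diagonal from \<open>V 1\<close> to \<open>V 3\<close> splits it into two positive triangle
  terms.\<close>

lemma det_pos: "cross2 a1 a2 > 0"
proof -
  have "8 * cross2 a1 a2 = cross2 (V 2 - V 1) (V 3 - V 1) + cross2 (V 4 - V 3) (V 1 - V 3)"
    by (simp add: a1_def a2_def cross2_def algebra_simps)
  then show ?thesis using turns(1) turns(5) by linarith
qed

lemma vecd_eq: "vecd V = s1 *\<^sub>R a1 + s2 *\<^sub>R a2"
proof -
  have M: "matA V *v x = x$1 *\<^sub>R a1 + x$2 *\<^sub>R a2" for x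
    by (simp add: matA_def a1_def a2_def matrix_vector_mult_def vec_eq_iff forall_2 sum_2
        transpose_def algebra_simps)
  have "det (matA V) = cross2 a1 a2"
    by (simp add: det_2 matA_def transpose_def a1_def a2_def cross2_def algebra_simps)
  then have "invertible (matA V)"
    using det_pos by (simp add: invertible_det_nz)
  \<comment> \<open>\<open>matrix_inv\<close> is defined by choice, so its inverse property has to
    come from invertibility.\<close>
  then have "matA V ** matrix_inv (matA V) = mat 1"
    unfolding invertible_def matrix_inv_def by (rule someI2_ex) blast
  then have "matA V *v svec V = vecd V"
    by (simp add: svec_def matrix_vector_mul_assoc)
  then show ?thesis by (simp add: M)
qed

text \<open>The corner (x, y) of the square with coordinates 1 and -1 goes to \<open>ctr\<close> + x
  \<open>a1\<close> + y \<open>a2\<close> + x y d. Writing d in the basis \<open>a1\<close>,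
  \<open>a2\<close> shifts the corner by x y (s1, s2); the factor k below is this x y.\<close>

lemma V_ref:
  "V 1 = ref (s1 - 1) (s2 - 1)" "V 2 = ref (1 - s1) (- 1 - s2)"
  "V 3 = ref (1 + s1) (1 + s2)" "V 4 = ref (- 1 - s1) (1 - s2)"
proof -
  have ref: "ref (x + k * s1) (y + k * s2) = ctr + x *\<^sub>R a1 + y *\<^sub>R a2 + k *\<^sub>R vecd V" for x y k
    by (simp add: ref_def vecd_eq algebra_simps)
  show "V 1 = ref (s1 - 1) (s2 - 1)" "V 2 = ref (1 - s1) (- 1 - s2)"
    "V 3 = ref (1 + s1) (1 + s2)" "V 4 = ref (- 1 - s1) (1 - s2)"
    using ref[of "-1" 1 "-1"] ref[of 1 "-1" "-1"] ref[of 1 1 1] ref[of "-1" "-1" 1]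
    by (simp_all add: ctr_def a1_def a2_def vecd_def vec_eq_iff forall_2 field_simps)
qed

lemma cross_ref:
  "cross2 (ref x y - ref x0 y0) (ref x' y' - ref x0 y0)
    = cross2 a1 a2 * ((x - x0) * (y' - y0) - (y - y0) * (x' - x0))"
  by (simp add: ref_def cross2_def algebra_simps)

lemma midpoint_ref: "midpoint (ref x y) (ref x' y') = ref ((x + x') / 2) ((y + y') / 2)"
  by (simp add: midpoint_def ref_def vec_eq_iff forall_2 field_simps)

lemma edge_mid_ref:
  "edge_mid V 1 = ref 0 (-1)" "edge_mid V 2 = ref 1 0" "edge_mid V 3 = ref 0 1" "edge_mid V 4
      = ref (-1) 0"
  unfolding edge_mid_def four_arith V_ref midpoint_ref
      by (simp_all add: add_divide_distrib diff_divide_distrib)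

text \<open>Each sum is, up to a positive factor, the area of a triangle cut off by a diagonal.
  Together they place (s1, s2) in the open diamond |s1| + |s2| < 1.\<close>

lemma s_bounds: "0 < 1 + s1 + s2" "0 < 1 + s1 - s2" "0 < 1 - s1 + s2" "0 < 1 - s1 - s2"
proof -
  have pos: "0 < x" if "0 < cross2 a1 a2 * (4 * x)" for x
    using that det_pos by (simp add: zero_less_mult_iff)
  show "0 < 1 + s1 + s2"
    using turns(3) unfolding V_ref cross_ref by - (rule pos, simp add: algebra_simps)
  show "0 < 1 + s1 - s2"
    using turns(5) unfolding V_ref cross_ref by - (rule pos, simp add: algebra_simps)
  show "0 < 1 - s1 + s2"
    using turns(1) unfolding V_ref cross_ref by - (rule pos, simp add: algebra_simps)
  show "0 < 1 - s1 - s2"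
    using turns(2) unfolding V_ref cross_ref by - (rule pos, simp add: algebra_simps)
qed

lemma s_abs_lt_1: "-1 < s1" "s1 < 1" "-1 < s2" "s2 < 1"
  using s_bounds by linarith+

text \<open>The diamond lies in the unit disc. The positive gap 1 - s1^2 - s2^2 is the factor that
  later removes \<open>phi1\<close> and \<open>phi2\<close>.\<close>

lemma s_sq: "s1\<^sup>2 + s2\<^sup>2 < 1"
proof -
  have "\<bar>s1\<bar> + \<bar>s2\<bar> < 1" using s_bounds by linarith
  then have "(\<bar>s1\<bar> + \<bar>s2\<bar>)\<^sup>2 < 1" by (simp add: power_less_one_iff abs_square_less_1)
  moreover have "s1\<^sup>2 + s2\<^sup>2 \<le> (\<bar>s1\<bar> + \<bar>s2\<bar>)\<^sup>2"
    by (simp add: power2_sum)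
  ultimately show ?thesis by linarith
qed

text \<open>An affine change of coordinates multiplies all signed areas by the same determinant,
  which cancels in the quotient.\<close>

lemma line_fun_ref:
  assumes "(x' - x) * (y'' - y) - (y' - y) * (x'' - x) \<noteq> 0"
  shows "line_fun (ref x y) (ref x' y') (ref x'' y'') (ref X Y)
    = ((x' - x) * (Y - y) - (y' - y) * (X - x)) / ((x' - x) * (y'' - y) - (y' - y) * (x'' - x))"
proof -
  have "cross2 (ref x' y' - ref x y) (ref x'' y'' - ref x y) \<noteq> 0"
    using assms det_pos unfolding cross_ref by (metis mult_eq_0_iff less_irrefl)
  then show ?thesis
    using det_pos unfolding line_fun_eq[OF \<open>cross2 _ _ \<noteq> 0\<close>] cross_ref
    by (intro mult_divide_mult_cancel_left) simp
qed

lemma line_funs_ref: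
  "l_edge V 1 (ref X Y) = (s2 * X + (1 - s1) * (Y + 1)) / (2 * (1 - s1))"
  "l_edge V 2 (ref X Y) = (s1 * Y - (1 + s2) * (X - 1)) / (2 * (1 + s2))"
  "l_edge V 3 (ref X Y) = (s2 * X - (1 + s1) * (Y - 1)) / (2 * (1 + s1))"
  "l_edge V 4 (ref X Y) = (s1 * Y + (1 - s2) * (X + 1)) / (2 * (1 - s2))"
  "m13 V (ref X Y) = X" "m24 V (ref X Y) = Y"
  "l13 V (ref X Y) = (Y - X + s1 - s2) / (2 * (1 + s1 - s2))"
  "l24 V (ref X Y) = (X + Y + s1 + s2) / (2 * (1 + s1 + s2))"
proof -
  note defs = l_edge_def m13_def m24_def l13_def l24_def four_arith edge_mid_ref V_ref
  show "l_edge V 1 (ref X Y) = (s2 * X + (1 - s1) * (Y + 1)) / (2 * (1 - s1))"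
    unfolding defs using s_abs_lt_1
        by (subst line_fun_ref) (simp_all add: divide_simps, simp_all add: algebra_simps)
  show "l_edge V 2 (ref X Y) = (s1 * Y - (1 + s2) * (X - 1)) / (2 * (1 + s2))"
    unfolding defs using s_abs_lt_1
        by (subst line_fun_ref) (simp_all add: divide_simps, simp_all add: algebra_simps)
  show "l_edge V 3 (ref X Y) = (s2 * X - (1 + s1) * (Y - 1)) / (2 * (1 + s1))"
    unfolding defs using s_abs_lt_1
        by (subst line_fun_ref) (simp_all add: divide_simps, simp_all add: algebra_simps)
  show "l_edge V 4 (ref X Y) = (s1 * Y + (1 - s2) * (X + 1)) / (2 * (1 - s2))"
    unfolding defs using s_abs_lt_1
        by (subst line_fun_ref) (simp_all add: divide_simps, simp_all add: algebra_simps)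
  show "m13 V (ref X Y) = X" "m24 V (ref X Y) = Y"
    unfolding defs by (subst line_fun_ref; simp)+
  show "l13 V (ref X Y) = (Y - X + s1 - s2) / (2 * (1 + s1 - s2))"
    unfolding defs using s_bounds
        by (subst line_fun_ref) (simp_all add: divide_simps, simp_all add: algebra_simps)
  show "l24 V (ref X Y) = (X + Y + s1 + s2) / (2 * (1 + s1 + s2))"
    unfolding defs using s_bounds
        by (subst line_fun_ref) (simp_all add: divide_simps, simp_all add: algebra_simps)
qed

lemma ref_surj: obtains X Y where "p = ref X Y"
proof
  let ?D = "cross2 a1 a2"
  \<comment> \<open>Cramer's rule, multiplied through by the determinant.\<close>
  have "?D *\<^sub>R (p - ctr) = cross2 (p - ctr) a2 *\<^sub>R a1 + cross2 a1 (p - ctr) *\<^sub>R a2"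
    by (simp add: vec_eq_iff forall_2 cross2_def algebra_simps)
  then have "(1 / ?D) *\<^sub>R (?D *\<^sub>R (p - ctr))
      = (cross2 (p - ctr) a2 / ?D) *\<^sub>R a1 + (cross2 a1 (p - ctr) / ?D) *\<^sub>R a2"
    by (simp add: scaleR_add_right)
  then show "p = ref (cross2 (p - ctr) a2 / ?D) (cross2 a1 (p - ctr) / ?D)"
    using det_pos by (simp add: ref_def algebra_simps)
qed

lemma real_polynomial_function_line_fun_ref:
  assumes "(x' - x) * (y'' - y) - (y' - y) * (x'' - x) \<noteq> 0"
  shows "real_polynomial_function (line_fun (ref x y) (ref x' y') (ref x'' y''))"
proof -
  have "cross2 (ref x' y' - ref x y) (ref x'' y'' - ref x y) \<noteq> 0"
    using assms det_pos unfolding cross_ref by (metis mult_eq_0_iff less_irrefl)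
  then show ?thesis
    unfolding line_fun_eq[OF \<open>cross2 _ _ \<noteq> 0\<close>] cross2_def
    by (auto simp only: vector_minus_component intro!: real_polynomial_function_divide
        real_polynomial_function_diff
        real_polynomial_function.intros(2-4) real_polynomial_function_vec_nth)
qed

lemma real_polynomial_function_line_funs:
  "real_polynomial_function (l_edge V i)" "real_polynomial_function (m13 V)"
      "real_polynomial_function (m24 V)"
  "real_polynomial_function (l13 V)" "real_polynomial_function (l24 V)"
proof -
  note defs = l_edge_def m13_def m24_def l13_def l24_def four_arith edge_mid_ref V_ref
  have "\<forall>i. real_polynomial_function (l_edge V i)"
    unfolding forall_4 defs using s_abs_lt_1
    by (intro conjI real_polynomial_function_line_fun_ref; simp add: algebra_simps)
  then show "real_polynomial_function (l_edge V i)" ..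
  show "real_polynomial_function (m13 V)" "real_polynomial_function (m24 V)"
    "real_polynomial_function (l13 V)" "real_polynomial_function (l24 V)"
    unfolding defs using s_bounds
    by (intro real_polynomial_function_line_fun_ref; simp add: algebra_simps)+
qed

lemma real_polynomial_function_phi:
  "real_polynomial_function (phi1 V)" "real_polynomial_function (phi2 V)"
      "real_polynomial_function (b0 V)"
  unfolding phi1_def phi2_def b0_def Let_def
  by (intro real_polynomial_function_power real_polynomial_function_diff
      real_polynomial_function.intros(2-4)
      real_polynomial_function_line_funs)+

lemma real_polynomial_function_stream: "real_polynomial_function (stream V c)"
  unfolding stream_def
  by (intro real_polynomial_function_power real_polynomial_function_diff
      real_polynomial_function.intros(2-4)
      real_polynomial_function_line_funs real_polynomial_function_phi
          real_polynomial_function_vec_nth)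

end

section \<open>Coefficient arrays for the sum space\<close>

lemma vector_4:
  "(vector [w, x, y, z] :: ('a::zero)^4) $ 1 = w"
  "(vector [w, x, y, z] :: ('a::zero)^4) $ 2 = x"
  "(vector [w, x, y, z] :: ('a::zero)^4) $ 3 = y"
  "(vector [w, x, y, z] :: ('a::zero)^4) $ 4 = z"
  unfolding vector_def by simp_all

lemma curl_lincomb4:
  assumes "real_polynomial_function f" "real_polynomial_function g"
    "real_polynomial_function h" "real_polynomial_function k"
  shows "curl (\<lambda>p. a * f p + b * g p + c * h p + d * k p) p
    = a *\<^sub>R curl f p + b *\<^sub>R curl g p + c *\<^sub>R curl h p + d *\<^sub>R curl k p"
  using assms by (simp add: curl_add curl_cmult real_polynomial_function.intros(2-4))

lemma vec_poly_space_1_iff: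
  "v \<in> vec_poly_space 1 \<longleftrightarrow> (\<exists>a b c a' b' c'. v = (\<lambda>p. vector [a + b * p$1 + c * p$2, a' + b' * p$1
      + c' * p$2]))"
proof
  assume "v \<in> vec_poly_space 1"
  then have "(\<exists>a b c. (\<lambda>p. v p $ 1) = (\<lambda>p. a + b * p$1 + c * p$2))" "\<exists>a' b' c'. (\<lambda>p. v p $ 2)
      = (\<lambda>p. a' + b' * p$1 + c' * p$2)"
    unfolding vec_poly_space_def poly_space_1 by auto
  then obtain a b c a' b' c' where "(\<lambda>p. v p $ 1) = (\<lambda>p. a + b * p$1 + c * p$2)" "(\<lambda>p. v p $ 2)
      = (\<lambda>p. a' + b' * p$1 + c' * p$2)"
    by blast
  then have "v = (\<lambda>p. vector [a + b * p$1 + c * p$2, a' + b' * p$1 + c' * p$2])"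
    by (simp add: fun_eq_iff vec_eq_iff forall_2)
  then show "(\<exists>a b c a' b' c'. v = (\<lambda>p. vector [a + b * p$1 + c * p$2, a' + b' * p$1 + c' * p$2]))"
    by blast
next
  assume "(\<exists>a b c a' b' c'. v = (\<lambda>p. vector [a + b * p$1 + c * p$2, a' + b' * p$1 + c' * p$2]))"
  then show "v \<in> vec_poly_space 1"
    unfolding vec_poly_space_def poly_space_1 by (elim exE) (simp, blast)
qed

text \<open>The scalar e is half the divergence; subtracting e p leaves a divergence-free affine
  field, which is the curl of a quadratic.\<close>

lemma vec_poly_space_velocity:
  assumes "v \<in> vec_poly_space 1"
  obtains e q1 q2 q3 q4 q5 where
    "v = (\<lambda>p. e *\<^sub>R p + vector [q2 + q3 * p$1 + 2 * q5 * p$2, - (q1 + q3 * p$2 + 2 * q4 * p$1)])"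
proof -
  obtain a b c a' b' c' where v: "v = (\<lambda>p. vector [a + b * p$1 + c * p$2, a' + b' * p$1
      + c' * p$2])"
    using assms unfolding vec_poly_space_1_iff by blast
  have "v = (\<lambda>p. ((b + c') / 2) *\<^sub>R p +
      vector [a + (b - c') / 2 * p$1 + 2 * (c / 2) * p$2, - (- a' + (b - c') / 2 * p$2
          + 2 * (- b' / 2) * p$1)])"
    unfolding v by (simp add: fun_eq_iff vec_eq_iff forall_2 field_simps)
  then show thesis by (rule that)
qed

context convex_quad
begin

text \<open>\<open>Vminus\<close> involves a span of curls, so its terms are split off one by one;
  the bubble term stays a single curl because \<open>Vb\<close> is the image of a span.\<close>

lemma curl_stream:
  "curl (stream V c) p =
     vector [c$1$3 + c$1$4 * p$1 + 2 * c$2$2 * p$2, - (c$1$2 + c$1$4 * p$2 + 2 * c$2$1 * p$1)]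
   + (c$2$3 *\<^sub>R curl (phi1 V) p + c$2$4 *\<^sub>R curl (phi2 V) p)
   + (c$3$1 *\<^sub>R curl (\<lambda>p. (p$1)^3) p + c$3$2 *\<^sub>R curl (\<lambda>p. (p$1)\<^sup>2 * p$2) p
    + c$3$3 *\<^sub>R curl (\<lambda>p. p$1 * (p$2)\<^sup>2) p + c$3$4 *\<^sub>R curl (\<lambda>p. (p$2)^3) p)
   + curl (\<lambda>p. c$4$1 * b0 V p + c$4$2 * (b0 V p * p$1) + c$4$3 * (b0 V p * p$2)
      + c$4$4 * (b0 V p * l13 V p * l24 V p)) p"
proof -
  note poly = real_polynomial_function_power real_polynomial_function_diff
      real_polynomial_function.intros(2-4)
      real_polynomial_function_line_funs real_polynomial_function_phi
          real_polynomial_function_vec_nth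
  define Q where "Q = (\<lambda>p::real^2. c$1$2 * p$1 + c$1$3 * p$2 + c$1$4 * (p$1 * p$2)
      + c$2$1 * (p$1)\<^sup>2 + c$2$2 * (p$2)\<^sup>2)"
  define P where "P = (\<lambda>p. c$2$3 * phi1 V p + c$2$4 * phi2 V p)"
  define C where "C = (\<lambda>p::real^2. c$3$1 * (p$1)^3 + c$3$2 * ((p$1)\<^sup>2 * p$2)
      + c$3$3 * (p$1 * (p$2)\<^sup>2) + c$3$4 * (p$2)^3)"
  define B where "B = (\<lambda>p. c$4$1 * b0 V p + c$4$2 * (b0 V p * p$1) + c$4$3 * (b0 V p * p$2)
      + c$4$4 * (b0 V p * l13 V p * l24 V p))"
  have S: "stream V c = (\<lambda>p. Q p + P p + C p + B p)"
    by (simp add: fun_eq_iff stream_def Q_def P_def C_def B_def)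
  have p: "real_polynomial_function Q" "real_polynomial_function P" "real_polynomial_function C"
      "real_polynomial_function B"
    unfolding Q_def P_def C_def B_def by (intro poly)+
  have "curl (stream V c) p = curl Q p + curl P p + curl C p + curl B p"
    unfolding S using p by (simp add: curl_add real_polynomial_function.intros(3))
  moreover have "curl P p = c$2$3 *\<^sub>R curl (phi1 V) p + c$2$4 *\<^sub>R curl (phi2 V) p"
    unfolding P_def
    by (simp add: curl_add curl_cmult real_polynomial_function_phi
        real_polynomial_function.intros(2-4))
  moreover have "curl C p = c$3$1 *\<^sub>R curl (\<lambda>p. (p$1)^3) p + c$3$2 *\<^sub>R curl (\<lambda>p. (p$1)\<^sup>2 * p$2) p
    + c$3$3 *\<^sub>R curl (\<lambda>p. p$1 * (p$2)\<^sup>2) p + c$3$4 *\<^sub>R curl (\<lambda>p. (p$2)^3) p"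
    unfolding C_def by (rule curl_lincomb4) (intro poly)+
  ultimately show ?thesis
    unfolding Q_def B_def curl_quadratic by simp
qed

lemma linear_velocity: "linear (velocity V)"
proof (rule linearI)
  fix c d :: "real^4^4" and k :: real
  have "stream V (c + d) = (\<lambda>p. stream V c p + stream V d p)"
    by (simp add: fun_eq_iff stream_linear)
  then show "velocity V (c + d) = velocity V c + velocity V d"
    unfolding velocity_def[abs_def] \<open>stream V (c + d) = _\<close>
    by (simp add: fun_eq_iff curl_add real_polynomial_function_stream algebra_simps)
  have "stream V (k *\<^sub>R c) = (\<lambda>p. k * stream V c p)"
    by (simp add: fun_eq_iff stream_linear)
  then show "velocity V (k *\<^sub>R c) = k *\<^sub>R velocity V c"
    unfolding velocity_def[abs_def] \<open>stream V (k *\<^sub>R c) = _\<close>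
    by (simp add: fun_eq_iff curl_cmult
        real_polynomial_function_stream algebra_simps scaleR_fun_def)
qed

lemma continuous_on_velocity: "continuous_on S (velocity V c)"
  unfolding velocity_def [abs_def]
  by (intro continuous_intros continuous_on_curl real_polynomial_function_stream)

text \<open>Makes the sum space the image of a 16-dimensional coefficient space, where dimensions
  can be counted.\<close>

lemma range_velocity: "{u + w | u w. u \<in> Vminus V \<and> w \<in> Vb V} = range (velocity V)"
proof (intro set_eqI iffI)
  fix v assume "v \<in> {u + w | u w. u \<in> Vminus V \<and> w \<in> Vb V}"
  then obtain u1 u2 g where v: "v = u1 + u2 + curl g" and u1: "u1 \<in> vec_poly_space 1"
    and u2: "u2 \<in> span {curl (\<lambda>p. (p$1)^3), curl (\<lambda>p. (p$1)\<^sup>2 * p$2), curl (\<lambda>p. p$1 * (p$2)\<^sup>2),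
               curl (\<lambda>p. (p$2)^3), curl (phi1 V), curl (phi2 V)}"
    and g: "g \<in> Wb V"
    unfolding Vminus_def Vb_def by blast
  obtain e q1 q2 q3 q4 q5 where u1:
    "u1 = (\<lambda>p. e *\<^sub>R p + vector [q2 + q3 * p$1 + 2 * q5 * p$2, - (q1 + q3 * p$2 + 2 * q4 * p$1)])"
    using u1 by (rule vec_poly_space_velocity)
  from u2[unfolded span_insert6] obtain k1 k2 k3 k4 k5 k6 where u2:
    "u2 = k1 *\<^sub>R curl (\<lambda>p. (p$1)^3) + k2 *\<^sub>R curl (\<lambda>p. (p$1)\<^sup>2 * p$2)
        + k3 *\<^sub>R curl (\<lambda>p. p$1 * (p$2)\<^sup>2)
      + k4 *\<^sub>R curl (\<lambda>p. (p$2)^3) + k5 *\<^sub>R curl (phi1 V) + k6 *\<^sub>R curl (phi2 V)"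
    by blast
  from g[unfolded Wb_def span_insert4] obtain j1 j2 j3 j4 where
    "g = j1 *\<^sub>R b0 V + j2 *\<^sub>R (\<lambda>p. b0 V p * p$1) + j3 *\<^sub>R (\<lambda>p. b0 V p * p$2)
        + j4 *\<^sub>R (\<lambda>p. b0 V p * l13 V p * l24 V p)"
    by blast
  then have g: "g = (\<lambda>p. j1 * b0 V p + j2 * (b0 V p * p$1) + j3 * (b0 V p * p$2)
      + j4 * (b0 V p * l13 V p * l24 V p))"
    by (simp add: fun_eq_iff scaleR_fun_def)
  \<comment> \<open>The layout is that of \<open>stream\<close>: k5 and k6 belong to
    \<open>phi1\<close> and \<open>phi2\<close>, which precede the cubics there.\<close>
  define c :: "real^4^4" where
    "c = vector [vector [e, q1, q2, q3], vector [q4, q5, k5, k6], vector [k1, k2, k3, k4], vector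
        [j1, j2, j3, j4]]"
  have "velocity V c = v"
    unfolding velocity_def curl_stream v u1 u2 g
    by (simp add: fun_eq_iff c_def vector_4 scaleR_fun_def)
  then show "v \<in> range (velocity V)" by blast
next
  fix v assume "v \<in> range (velocity V)"
  then obtain c where v: "v = velocity V c" by blast
  let ?u1 = "\<lambda>p::real^2. c$1$1 *\<^sub>R p + vector [c$1$3 + c$1$4 * p$1 + 2 * c$2$2 * p$2, - (c$1$2
      + c$1$4 * p$2 + 2 * c$2$1 * p$1)]"
  let ?u2 = "c$3$1 *\<^sub>R curl (\<lambda>p. (p$1)^3) + c$3$2 *\<^sub>R curl (\<lambda>p. (p$1)\<^sup>2 * p$2)
    + c$3$3 *\<^sub>R curl (\<lambda>p. p$1 * (p$2)\<^sup>2) + c$3$4 *\<^sub>R curl (\<lambda>p. (p$2)^3) + c$2$3 *\<^sub>R curl (phi1 V)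
        + c$2$4 *\<^sub>R curl (phi2 V)"
  let ?g = "\<lambda>p. c$4$1 * b0 V p + c$4$2 * (b0 V p * p$1) + c$4$3 * (b0 V p * p$2)
      + c$4$4 * (b0 V p * l13 V p * l24 V p)"
  have "?u1 = (\<lambda>p. vector [c$1$3 + (c$1$1 + c$1$4) * p$1 + (2 * c$2$2) * p$2,
     - c$1$2 + (- 2 * c$2$1) * p$1 + (c$1$1 - c$1$4) * p$2])"
    by (simp add: fun_eq_iff vec_eq_iff forall_2 algebra_simps)
  then have "?u1 \<in> vec_poly_space 1"
    unfolding vec_poly_space_1_iff by blast
  moreover have "?u2 \<in> span {curl (\<lambda>p. (p$1)^3), curl (\<lambda>p. (p$1)\<^sup>2 * p$2), curl (\<lambda>p. p$1 * (p$2)\<^sup>2),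
               curl (\<lambda>p. (p$2)^3), curl (phi1 V), curl (phi2 V)}"
    unfolding span_insert6 by blast
  ultimately have "?u1 + ?u2 \<in> Vminus V" unfolding Vminus_def by blast
  moreover have "?g = c$4$1 *\<^sub>R b0 V + c$4$2 *\<^sub>R (\<lambda>p. b0 V p * p$1) + c$4$3 *\<^sub>R (\<lambda>p. b0 V p * p$2)
        + c$4$4 *\<^sub>R (\<lambda>p. b0 V p * l13 V p * l24 V p)"
    by (simp add: fun_eq_iff scaleR_fun_def)
  then have "?g \<in> Wb V" unfolding Wb_def span_insert4 by blast
  then have "curl ?g \<in> Vb V" unfolding Vb_def by blast
  moreover have "v = (?u1 + ?u2) + curl ?g"
    unfolding v velocity_def curl_stream by (simp add: fun_eq_iff scaleR_fun_def)
  ultimately show "v \<in> {u + w | u w. u \<in> Vminus V \<and> w \<in> Vb V}" by blast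
qed

lemma vec_poly_space_in_range:
  assumes "v \<in> vec_poly_space 1"
  shows "v \<in> range (velocity V)"
proof -
  obtain e q1 q2 q3 q4 q5 where v:
    "v = (\<lambda>p. e *\<^sub>R p + vector [q2 + q3 * p$1 + 2 * q5 * p$2, - (q1 + q3 * p$2 + 2 * q4 * p$1)])"
    using assms by (rule vec_poly_space_velocity)
  have "v = velocity V (vector [vector [e, q1, q2, q3], vector [q4, q5, 0, 0], 0, 0])"
    unfolding v velocity_def curl_stream by (simp add: fun_eq_iff vector_4 curl_const)
  then show ?thesis by blast
qed

end

section \<open>Polynomial identities\<close>

text \<open>Odd powers of the centred variable integrate to zero, and its second and fourth powers
  have means 1/3 and 1/5.\<close>

lemma integral_centred_quintic:
  fixes r :: "real \<Rightarrow> real"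
  assumes "\<And>s. r s = a + b * (2 * s - 1) + c * (2 * s - 1)^2 + d * (2 * s - 1)^3 + e * (2 * s
      - 1)^4 + f * (2 * s - 1)^5"
  shows "integral {0..1} r = a + c / 3 + e / 5"
proof -
  define R where "R = (\<lambda>s::real. a * s + b * (2 * s - 1)^2 / 4 + c * (2 * s - 1)^3 / 6
      + d * (2 * s - 1)^4 / 8
     + e * (2 * s - 1)^5 / 10 + f * (2 * s - 1)^6 / 12)"
  have "(R has_vector_derivative r s) (at s within {0..1})" for s
    unfolding R_def assms has_real_derivative_iff_has_vector_derivative[symmetric]
    by (rule derivative_eq_intros refl | simp)+
  then have "(r has_integral (R 1 - R 0)) {0..1}"
    by (intro fundamental_theorem_of_calculus) auto
  then show ?thesis
    by (simp add: integral_unique R_def)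
qed

text \<open>Divided by 5 m, the last hypothesis evaluates an affine function near an edge midpoint.
  Since s^2 <= m and |s| n <= 2 m, the shift is at most 1/5 in the coefficient of B and 2/5 in that
  of C.\<close>

lemma weighted_sign:
  fixes A B C m n s :: real
  assumes "\<bar>s\<bar> \<le> m" "\<bar>s\<bar> \<le> 1" "0 < m" "0 \<le> n" "n \<le> 2"
    and "0 \<le> 5 * m * (A + B) + s * (s * B + n * C)"
  shows "0 \<le> A + B + \<bar>B\<bar> / 5 + 2 * \<bar>C\<bar> / 5"
proof -
  have "s * s \<le> m"
    using mult_left_le[of "\<bar>s\<bar>" "\<bar>s\<bar>"] assms(1,2) by simp
  then have "s * s * B \<le> m * \<bar>B\<bar>"
    by (smt (verit) mult_mono mult_minus_right mult_nonneg_nonneg zero_le_square)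
  moreover have "s * n * C \<le> m * 2 * \<bar>C\<bar>"
  proof -
    have "s * n * C \<le> \<bar>s\<bar> * n * \<bar>C\<bar>"
      using assms(4) by (metis abs_ge_self abs_mult abs_of_nonneg)
    also have "\<dots> \<le> m * 2 * \<bar>C\<bar>"
      using assms by (intro mult_mono) auto
    finally show ?thesis .
  qed
  ultimately have "0 \<le> 5 * m * (A + B) + m * \<bar>B\<bar> + m * 2 * \<bar>C\<bar>"
    using assms(6) by (simp add: algebra_simps)
  also have "\<dots> = 5 * m * (A + B + \<bar>B\<bar> / 5 + 2 * \<bar>C\<bar> / 5)"
    by (simp add: algebra_simps)
  finally show ?thesis
    using assms(3) by (simp add: zero_le_mult_iff)
qed

text \<open>Each equation prescribes the sign of \<open>A + B x + C y\<close> at a point in the middle fifth of one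
  edge. The signs alternate around the quadrilateral, which forces the affine function to vanish.\<close>

lemma alternating_signs:
  fixes A B C s t w :: real
  assumes st: "0 < 1 + s + t" "0 < 1 + s - t" "0 < 1 - s + t" "0 < 1 - s - t"
    and k: "0 < k1" "0 < k2" "0 < k3" "0 < k4"
    and e1: "5 * (1 + s) * (A - C) + t * ((1 - s) * B - t * C) = - k1 * w"
    and e2: "5 * (1 - t) * (A + B) + s * (s * B + (1 + t) * C) = k2 * w"
    and e3: "5 * (1 - s) * (A + C) + t * ((1 + s) * B + t * C) = - k3 * w"
    and e4: "5 * (1 + t) * (A - B) - s * (s * B - (1 - t) * C) = k4 * w"
  shows "A = 0 \<and> B = 0 \<and> C = 0 \<and> w = 0"
proof -
  have nonneg: "A = 0 \<and> B = 0 \<and> C = 0" if w: "0 \<le> w"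
    and e1: "5 * (1 + s) * (A - C) + t * ((1 - s) * B - t * C) = - k1 * w"
    and e2: "5 * (1 - t) * (A + B) + s * (s * B + (1 + t) * C) = k2 * w"
    and e3: "5 * (1 - s) * (A + C) + t * ((1 + s) * B + t * C) = - k3 * w"
    and e4: "5 * (1 + t) * (A - B) - s * (s * B - (1 - t) * C) = k4 * w"
    for A B C w
  proof -
    have kw: "0 \<le> k1 * w" "0 \<le> k2 * w" "0 \<le> k3 * w" "0 \<le> k4 * w"
      using k w by simp_all
    have "0 \<le> A + B + \<bar>B\<bar> / 5 + 2 * \<bar>C\<bar> / 5"
      using st e2 kw by (intro weighted_sign[of s "1 - t" "1 + t"]) auto
    moreover have "0 \<le> A + - B + \<bar>- B\<bar> / 5 + 2 * \<bar>C\<bar> / 5"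
      using st e4 kw by (intro weighted_sign[of s "1 + t" "1 - t"]) (auto simp: algebra_simps)
    moreover have "0 \<le> - A + C + \<bar>C\<bar> / 5 + 2 * \<bar>- B\<bar> / 5"
      using st e1 kw by (intro weighted_sign[of t "1 + s" "1 - s"]) (auto simp: algebra_simps)
    moreover have "0 \<le> - A + - C + \<bar>- C\<bar> / 5 + 2 * \<bar>- B\<bar> / 5"
      using st e3 kw by (intro weighted_sign[of t "1 - s" "1 + s"]) (auto simp: algebra_simps)
    \<comment> \<open>The first two bounds give A >= 4/5 |B| - 2/5 |C|, the last two give -A >= 4/5
      |C| - 2/5 |B|; adding them forces B = C = 0.\<close>
    ultimately show ?thesis by (auto simp: abs_if split: if_splits)
  qed
  have "A = 0 \<and> B = 0 \<and> C = 0"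
  proof (cases "0 \<le> w")
    case True
    then show ?thesis using nonneg e1 e2 e3 e4 by blast
  next
    case False
    \<comment> \<open>The system is homogeneous, so changing all signs reduces to the first case.
      The arguments follow the order of occurrence w, A, C, B.\<close>
    then show ?thesis
      using nonneg[of "-w" "-A" "-C" "-B"] e1 e2 e3 e4 by (simp add: algebra_simps)
  qed
  with e2 k show ?thesis by simp
qed

text \<open>The ten points sampled below determine the ten coefficients of a cubic in two
  variables.\<close>

lemma cubic_eq_const:
  fixes k1 :: real
  assumes "\<And>x y. k1 * x + k2 * y + k3 * (x * y) + k4 * x\<^sup>2 + k5 * y\<^sup>2
    + (k6 * x^3 + k7 * (x\<^sup>2 * y) + k8 * (x * y\<^sup>2) + k9 * y^3) = k0"
  shows "k1 = 0 \<and> k2 = 0 \<and> k3 = 0 \<and> k4 = 0 \<and> k5 = 0 \<and> k6 = 0 \<and> k7 = 0 \<and> k8 = 0 \<and> k9 = 0"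
proof -
  note eqs = assms[of 0 0, simplified] assms[of 1 0, simplified] assms[of "-1" 0, simplified]
    assms[of 2 0, simplified] assms[of 0 1, simplified] assms[of 0 "-1", simplified]
    assms[of 0 2, simplified] assms[of 1 1, simplified] assms[of 1 "-1", simplified]
    assms[of "-1" 1, simplified]
  show ?thesis
    by (intro conjI; insert eqs; linarith)
qed

text \<open>The degree is three in total, not in each variable; the digits of a coefficient are the
  exponents of x and y.\<close>

definition bicubic where
  "bicubic q00 q10 q01 q20 q11 q02 q30 q21 q12 q03 x y = q00 + q10 * x + q01 * y + q20 * x\<^sup>2
      + q11 * (x * y)
    + q02 * y\<^sup>2 + q30 * x^3 + q21 * (x\<^sup>2 * y) + q12 * (x * y\<^sup>2) + q03 * (y::real)^3"

text \<open>Subtracting multiples of \<open>m\<^sub>2\<^sub>4 l\<^sub>1 l\<^sub>3\<close> and \<open>m\<^sub>1\<^sub>3 l\<^sub>2 l\<^sub>4\<close> leaves \<open>q\<^sub>0\<^sub>0 (1 - x\<^sup>2 - y\<^sup>2)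
    + x y L\<close> with
  \<open>L\<close> affine. The affine dependence of the four vertices, with the weights used below, eliminates
      \<open>L\<close>.\<close>

lemma cubic_vanishing_at_vertices_and_midpoints:
  fixes s t :: real
  assumes st: "0 < 1 + s + t" "0 < 1 + s - t" "0 < 1 - s + t" "0 < 1 - s - t"
    and Q: "Q = bicubic q00 q10 q01 q20 q11 q02 q30 q21 q12 q03"
    and mid: "Q 0 (-1) = 0" "Q 1 0 = 0" "Q 0 1 = 0" "Q (-1) 0 = 0"
    and vert: "Q (s - 1) (t - 1) = 0" "Q (1 - s) (- 1 - t) = 0" "Q (1 + s) (1 + t) = 0" "Q (- 1
        - s) (1 - t) = 0"
  obtains a b where
    "Q = (\<lambda>x y. a * y * (t * x + (1 - s) * (y + 1)) * (t * x - (1 + s) * (y - 1))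
              + b * x * (s * y - (1 + t) * (x - 1)) * (s * y + (1 - t) * (x + 1)))"
proof -
  have lt: "-1 < s" "s < 1" "-1 < t" "t < 1" using st by linarith+
  have sq: "s\<^sup>2 < 1" "t\<^sup>2 < 1" using lt by (simp_all add: abs_square_less_1 abs_less_iff)
  \<comment> \<open>The two products have y-coefficient 1 - s^2 and x-coefficient 1 - t^2
    respectively, so this choice matches the linear terms of \<open>Q\<close>.\<close>
  define a b where "a = q01 / (1 - s\<^sup>2)" and "b = q10 / (1 - t\<^sup>2)"
  have ab: "q01 = a * (1 - s\<^sup>2)" "q10 = b * (1 - t\<^sup>2)"
    using sq by (simp_all add: a_def b_def)
  define p11 p21 p12 where "p11 = q11 - 2 * t * a - 2 * s * b" and "p21 = q21 - t\<^sup>2 * a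
      + 2 * s * t * b"
    and "p12 = q12 + 2 * s * t * a - s\<^sup>2 * b"
  have co: "q20 = - q00" "q30 = - q10" "q02 = - q00" "q03 = - q01"
    using mid by (simp_all add: Q bicubic_def)
  define R where "R x y = q00 * (1 - x\<^sup>2 - y\<^sup>2) + x * y * (p11 + p21 * x + p12 * y)" for x y :: real
  have Q': "Q x y = a * y * (t * x + (1 - s) * (y + 1)) * (t * x - (1 + s) * (y - 1))
              + b * x * (s * y - (1 + t) * (x - 1)) * (s * y + (1 - t) * (x + 1)) + R x y" for x y
    unfolding Q bicubic_def R_def co ab p11_def p21_def p12_def
    by (simp add: algebra_simps power2_eq_square power3_eq_cube)
  have R: "R (s - 1) (t - 1) = 0" "R (1 - s) (- 1 - t) = 0" "R (1 + s) (1 + t) = 0" "R (- 1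
      - s) (1 - t) = 0"
    using vert unfolding Q' by (simp_all add: algebra_simps)
  \<comment> \<open>Multiplied by x y at its vertex, each weight becomes (1 - s^2)(1 - t^2) times a
    coefficient of the affine dependence: 1 + s + t, -(1 + s - t), 1 - s - t, -(1 - s + t).\<close>
  have "4 * (q00 * ((1 - (s + t)\<^sup>2) * (1 - (s - t)\<^sup>2)))
    = - ((1 + s + t) * (1 + s) * (1 + t) * R (s - 1) (t - 1) + (1 + s - t) * (1 + s) * (1
        - t) * R (1 - s) (- 1 - t)
      + (1 - s - t) * (1 - s) * (1 - t) * R (1 + s) (1 + t) + (1 - s + t) * (1 - s) * (1
          + t) * R (- 1 - s) (1 - t))"
    unfolding R_def by (simp add: algebra_simps power2_eq_square)
  then have "q00 * ((1 - (s + t)\<^sup>2) * (1 - (s - t)\<^sup>2)) = 0"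
    unfolding R by simp
  moreover have "(s + t)\<^sup>2 < 1" "(s - t)\<^sup>2 < 1"
    using st by (simp_all add: abs_square_less_1 abs_less_iff)
  ultimately have q0: "q00 = 0" by auto
  \<comment> \<open>With \<open>q00 = 0\<close> the nonzero factor x y cancels at each vertex,
    leaving an affine function with four zeros that are not collinear.\<close>
  have "p11 + p21 * (s - 1) + p12 * (t - 1) = 0" "p11 + p21 * (1 - s) + p12 * (- 1 - t) = 0"
    "p11 + p21 * (1 + s) + p12 * (1 + t) = 0" "p11 + p21 * (- 1 - s) + p12 * (1 - t) = 0"
    using R lt unfolding R_def q0 by simp_all
  then have p: "p11 + s * p21 + t * p12 = 0" "p21 + p12 = 0" "p12 - p21 = 0"
    by (simp_all add: algebra_simps)
  then have "p12 = 0" "p21 = 0" by linarith+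
  then have "p11 = 0" using p by simp
  with Q' q0 \<open>p12 = 0\<close> \<open>p21 = 0\<close> show thesis
    by (intro that[of a b]) (simp add: fun_eq_iff R_def)
qed

section \<open>Traces on the edges\<close>

lemma mult_quotients:
  fixes k k' :: real
  shows "a * u / (2 * k) * (b * v / (2 * k')) * w * z = a * b / (4 * (k * k')) * (u * v * w * z)"
  by simp

context convex_quad
begin

text \<open>Here \<open>\<tau>\<close> is -1 and 1 at the ends and 0 at the midpoint, so parity in
  \<open>\<tau>\<close> expresses symmetry about the midpoint.\<close>

lemma linepath_ref:
  fixes s :: real
  defines "\<tau> \<equiv> 2 * s - 1"
  shows "linepath (V 1) (V 2) s = ref ((1 - s1) * \<tau>) (- 1 - s2 * \<tau>)"
    "linepath (V 2) (V 3) s = ref (1 + s1 * \<tau>) ((1 + s2) * \<tau>)"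
    "linepath (V 3) (V 4) s = ref (- (1 + s1) * \<tau>) (1 - s2 * \<tau>)"
    "linepath (V 4) (V 1) s = ref (- 1 + s1 * \<tau>) (- (1 - s2) * \<tau>)"
proof -
  have lin: "linepath (ref x y) (ref x' y') s = ref ((1 - s) * x + s * x') ((1 - s) * y + s * y')"
      for x y x' y'
    by (simp add: linepath_def ref_def algebra_simps)
  show "linepath (V 1) (V 2) s = ref ((1 - s1) * \<tau>) (- 1 - s2 * \<tau>)"
    "linepath (V 2) (V 3) s = ref (1 + s1 * \<tau>) ((1 + s2) * \<tau>)"
    "linepath (V 3) (V 4) s = ref (- (1 + s1) * \<tau>) (1 - s2 * \<tau>)"
    "linepath (V 4) (V 1) s = ref (- 1 + s1 * \<tau>) (- (1 - s2) * \<tau>)"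
    unfolding V_ref lin \<tau>_def by (auto intro!: arg_cong2[where f = ref] simp: algebra_simps)
qed

lemma on_edge1:
  fixes s :: real
  defines "\<tau> \<equiv> 2 * s - 1" and "p \<equiv> linepath (V 1) (V 2) s"
  shows "l_edge V 1 p = 0" "l_edge V 2 p = (1 - s1 + s2) * (1 - \<tau>) / (2 * (1 + s2))"
    "l_edge V 3 p = (1 + s1 + s2 * \<tau>) / (1 + s1)" "l_edge V 4 p = (1 - s1 - s2) * (1
        + \<tau>) / (2 * (1 - s2))"
    "m13 V p = (1 - s1) * \<tau>" "m24 V p = - 1 - s2 * \<tau>"
    "l13 V p = - ((1 - s1 + s2) * (1 + \<tau>)) / (2 * (1 + s1 - s2))"
    "l24 V p = - ((1 - s1 - s2) * (1 - \<tau>)) / (2 * (1 + s1 + s2))"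
  unfolding p_def linepath_ref \<tau>_def[symmetric] line_funs_ref
  using s_bounds s_abs_lt_1 by (simp_all add: divide_simps) (simp_all add: algebra_simps)

lemma on_edge2:
  fixes s :: real
  defines "\<tau> \<equiv> 2 * s - 1" and "p \<equiv> linepath (V 2) (V 3) s"
  shows "l_edge V 1 p = (1 - s1 + s2) * (1 + \<tau>) / (2 * (1 - s1))" "l_edge V 2 p = 0"
    "l_edge V 3 p = (1 + s1 + s2) * (1 - \<tau>) / (2 * (1 + s1))" "l_edge V 4 p = (1 - s2
        + s1 * \<tau>) / (1 - s2)"
    "m13 V p = 1 + s1 * \<tau>" "m24 V p = (1 + s2) * \<tau>"
    "l13 V p = - ((1 - s1 + s2) * (1 - \<tau>)) / (2 * (1 + s1 - s2))"
    "l24 V p = (1 + s1 + s2) * (1 + \<tau>) / (2 * (1 + s1 + s2))"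
  unfolding p_def linepath_ref \<tau>_def[symmetric] line_funs_ref
  using s_bounds s_abs_lt_1 by (simp_all add: divide_simps) (simp_all add: algebra_simps)

lemma on_edge3:
  fixes s :: real
  defines "\<tau> \<equiv> 2 * s - 1" and "p \<equiv> linepath (V 3) (V 4) s"
  shows "l_edge V 1 p = (1 - s1 - s2 * \<tau>) / (1 - s1)" "l_edge V 2 p = (1 + s1 + s2) * (1
      + \<tau>) / (2 * (1 + s2))"
    "l_edge V 3 p = 0" "l_edge V 4 p = (1 + s1 - s2) * (1 - \<tau>) / (2 * (1 - s2))"
    "m13 V p = - (1 + s1) * \<tau>" "m24 V p = 1 - s2 * \<tau>"
    "l13 V p = (1 + s1 - s2) * (1 + \<tau>) / (2 * (1 + s1 - s2))"
    "l24 V p = (1 + s1 + s2) * (1 - \<tau>) / (2 * (1 + s1 + s2))"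
  unfolding p_def linepath_ref \<tau>_def[symmetric] line_funs_ref
  using s_bounds s_abs_lt_1 by (simp_all add: divide_simps) (simp_all add: algebra_simps)

lemma on_edge4:
  fixes s :: real
  defines "\<tau> \<equiv> 2 * s - 1" and "p \<equiv> linepath (V 4) (V 1) s"
  shows "l_edge V 1 p = (1 - s1 - s2) * (1 - \<tau>) / (2 * (1 - s1))" "l_edge V 2 p = (1 + s2
      - s1 * \<tau>) / (1 + s2)"
    "l_edge V 3 p = (1 + s1 - s2) * (1 + \<tau>) / (2 * (1 + s1))" "l_edge V 4 p = 0"
    "m13 V p = - 1 + s1 * \<tau>" "m24 V p = - (1 - s2) * \<tau>"
    "l13 V p = (1 + s1 - s2) * (1 - \<tau>) / (2 * (1 + s1 - s2))"
    "l24 V p = - ((1 - s1 - s2) * (1 + \<tau>)) / (2 * (1 + s1 + s2))"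
  unfolding p_def linepath_ref \<tau>_def[symmetric] line_funs_ref
  using s_bounds s_abs_lt_1 by (simp_all add: divide_simps) (simp_all add: algebra_simps)

text \<open>The common factors carry the zeros at vertices and edge midpoints; only the last factor
  depends on the special coefficients.\<close>

lemma phi_factor:
  "phi1 V p = l_edge V 1 p * l_edge V 3 p * m24 V p * ((s2 - 1) * (s2 + 1) * m13 V p
      - s1 * s2 * m24 V p + s1 * m24 V p * m13 V p)"
  "phi2 V p = l_edge V 2 p * l_edge V 4 p * m13 V p * ((s1 - 1) * (s1 + 1) * m24 V p
      - s1 * s2 * m13 V p + s2 * m13 V p * m24 V p)"
  by (simp_all add: phi1_def phi2_def Let_def power2_eq_square algebra_simps)

lemma one_minus_s_sq: "1 - s1\<^sup>2 = (1 - s1) * (1 + s1)" "1 - s2\<^sup>2 = (1 + s2) * (1 - s2)"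
  by (simp_all add: power2_eq_square algebra_simps)

text \<open>The coefficients of \<open>\<phi>\<^sub>1\<close> and \<open>\<phi>\<^sub>2\<close> are tuned so that the linear term of the last factor drops
  out on each edge. This makes the traces odd about the edge midpoint.\<close>

lemma phi1_on_edges:
  fixes s :: real
  defines "\<tau> \<equiv> 2 * s - 1"
  shows "phi1 V (linepath (V 1) (V 2) s) = 0"
    "phi1 V (linepath (V 2) (V 3) s) = (1 - s1 + s2) * (1 + s1 + s2) * (1 + s2)\<^sup>2 / (4 * (1 - s1\<^sup>2))
        * (\<tau> * (1 - \<tau>\<^sup>2) * (- (1 - s2) + s1\<^sup>2 * \<tau>\<^sup>2))"
    "phi1 V (linepath (V 3) (V 4) s) = 0"
    "phi1 V (linepath (V 4) (V 1) s) = (1 - s1 - s2) * (1 + s1 - s2) * (1 - s2)\<^sup>2 / (4 * (1 - s1\<^sup>2))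
        * (\<tau> * (1 - \<tau>\<^sup>2) * (- (1 + s2) + s1\<^sup>2 * \<tau>\<^sup>2))"
proof -
  show "phi1 V (linepath (V 1) (V 2) s) = 0" "phi1 V (linepath (V 3) (V 4) s) = 0"
    unfolding phi_factor on_edge1 on_edge3 by simp_all
  have "phi1 V (linepath (V 2) (V 3) s) = (1 - s1 + s2) * (1 + s1 + s2) / (4 * (1 - s1\<^sup>2)) *
    ((1 + \<tau>) * (1 - \<tau>) * ((1 + s2) * \<tau>) *
     ((s2 - 1) * (s2 + 1) * (1 + s1 * \<tau>) - s1 * s2 * ((1 + s2) * \<tau>) + s1 * ((1 + s2) * \<tau>) * (1
         + s1 * \<tau>)))"
    unfolding phi_factor on_edge2 \<tau>_def[symmetric] one_minus_s_sq by (rule mult_quotients)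
  also have "(1 + \<tau>) * (1 - \<tau>) * ((1 + s2) * \<tau>) *
     ((s2 - 1) * (s2 + 1) * (1 + s1 * \<tau>) - s1 * s2 * ((1 + s2) * \<tau>) + s1 * ((1 + s2) * \<tau>) * (1
         + s1 * \<tau>))
     = (1 + s2)\<^sup>2 * (\<tau> * (1 - \<tau>\<^sup>2) * (- (1 - s2) + s1\<^sup>2 * \<tau>\<^sup>2))"
    by (simp add: power2_eq_square algebra_simps)
  finally show "phi1 V (linepath (V 2) (V 3) s) = (1 - s1 + s2) * (1 + s1 + s2) * (1
      + s2)\<^sup>2 / (4 * (1 - s1\<^sup>2))
        * (\<tau> * (1 - \<tau>\<^sup>2) * (- (1 - s2) + s1\<^sup>2 * \<tau>\<^sup>2))"
    by simp
  have "phi1 V (linepath (V 4) (V 1) s) = (1 - s1 - s2) * (1 + s1 - s2) / (4 * (1 - s1\<^sup>2)) *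
    ((1 - \<tau>) * (1 + \<tau>) * (- (1 - s2) * \<tau>) *
     ((s2 - 1) * (s2 + 1) * (- 1 + s1 * \<tau>) - s1 * s2 * (- (1 - s2) * \<tau>) + s1 * (- (1
         - s2) * \<tau>) * (- 1 + s1 * \<tau>)))"
    unfolding phi_factor on_edge4 \<tau>_def[symmetric] one_minus_s_sq by (rule mult_quotients)
  also have "(1 - \<tau>) * (1 + \<tau>) * (- (1 - s2) * \<tau>) *
     ((s2 - 1) * (s2 + 1) * (- 1 + s1 * \<tau>) - s1 * s2 * (- (1 - s2) * \<tau>) + s1 * (- (1
         - s2) * \<tau>) * (- 1 + s1 * \<tau>))
     = (1 - s2)\<^sup>2 * (\<tau> * (1 - \<tau>\<^sup>2) * (- (1 + s2) + s1\<^sup>2 * \<tau>\<^sup>2))"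
    by (simp add: power2_eq_square algebra_simps)
  finally show "phi1 V (linepath (V 4) (V 1) s) = (1 - s1 - s2) * (1 + s1 - s2) * (1
      - s2)\<^sup>2 / (4 * (1 - s1\<^sup>2))
        * (\<tau> * (1 - \<tau>\<^sup>2) * (- (1 + s2) + s1\<^sup>2 * \<tau>\<^sup>2))"
    by simp
qed

lemma phi2_on_edges:
  fixes s :: real
  defines "\<tau> \<equiv> 2 * s - 1"
  shows "phi2 V (linepath (V 1) (V 2) s) = (1 - s1 + s2) * (1 - s1 - s2) * (1 - s1)\<^sup>2 / (4 * (1
      - s2\<^sup>2))
        * (\<tau> * (1 - \<tau>\<^sup>2) * (1 + s1 - s2\<^sup>2 * \<tau>\<^sup>2))"
    "phi2 V (linepath (V 2) (V 3) s) = 0"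
    "phi2 V (linepath (V 3) (V 4) s) = (1 + s1 + s2) * (1 + s1 - s2) * (1 + s1)\<^sup>2 / (4 * (1 - s2\<^sup>2))
        * (\<tau> * (1 - \<tau>\<^sup>2) * (1 - s1 - s2\<^sup>2 * \<tau>\<^sup>2))"
    "phi2 V (linepath (V 4) (V 1) s) = 0"
proof -
  show "phi2 V (linepath (V 2) (V 3) s) = 0" "phi2 V (linepath (V 4) (V 1) s) = 0"
    unfolding phi_factor on_edge2 on_edge4 by simp_all
  have "phi2 V (linepath (V 1) (V 2) s) = (1 - s1 + s2) * (1 - s1 - s2) / (4 * (1 - s2\<^sup>2)) *
    ((1 - \<tau>) * (1 + \<tau>) * ((1 - s1) * \<tau>) *
     ((s1 - 1) * (s1 + 1) * (- 1 - s2 * \<tau>) - s1 * s2 * ((1 - s1) * \<tau>) + s2 * ((1 - s1) * \<tau>) * (- 1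
         - s2 * \<tau>)))"
    unfolding phi_factor on_edge1 \<tau>_def[symmetric] one_minus_s_sq by (rule mult_quotients)
  also have "(1 - \<tau>) * (1 + \<tau>) * ((1 - s1) * \<tau>) *
     ((s1 - 1) * (s1 + 1) * (- 1 - s2 * \<tau>) - s1 * s2 * ((1 - s1) * \<tau>) + s2 * ((1 - s1) * \<tau>) * (- 1
         - s2 * \<tau>))
     = (1 - s1)\<^sup>2 * (\<tau> * (1 - \<tau>\<^sup>2) * (1 + s1 - s2\<^sup>2 * \<tau>\<^sup>2))"
    by (simp add: power2_eq_square algebra_simps)
  finally show "phi2 V (linepath (V 1) (V 2) s) = (1 - s1 + s2) * (1 - s1 - s2) * (1
      - s1)\<^sup>2 / (4 * (1 - s2\<^sup>2))
        * (\<tau> * (1 - \<tau>\<^sup>2) * (1 + s1 - s2\<^sup>2 * \<tau>\<^sup>2))"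
    by simp
  have "phi2 V (linepath (V 3) (V 4) s) = (1 + s1 + s2) * (1 + s1 - s2) / (4 * (1 - s2\<^sup>2)) *
    ((1 + \<tau>) * (1 - \<tau>) * (- (1 + s1) * \<tau>) *
     ((s1 - 1) * (s1 + 1) * (1 - s2 * \<tau>) - s1 * s2 * (- (1 + s1) * \<tau>) + s2 * (- (1 + s1) * \<tau>) * (1
         - s2 * \<tau>)))"
    unfolding phi_factor on_edge3 \<tau>_def[symmetric] one_minus_s_sq by (rule mult_quotients)
  also have "(1 + \<tau>) * (1 - \<tau>) * (- (1 + s1) * \<tau>) *
     ((s1 - 1) * (s1 + 1) * (1 - s2 * \<tau>) - s1 * s2 * (- (1 + s1) * \<tau>) + s2 * (- (1 + s1) * \<tau>) * (1
         - s2 * \<tau>))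
     = (1 + s1)\<^sup>2 * (\<tau> * (1 - \<tau>\<^sup>2) * (1 - s1 - s2\<^sup>2 * \<tau>\<^sup>2))"
    by (simp add: power2_eq_square algebra_simps)
  finally show "phi2 V (linepath (V 3) (V 4) s) = (1 + s1 + s2) * (1 + s1 - s2) * (1
      + s1)\<^sup>2 / (4 * (1 - s2\<^sup>2))
        * (\<tau> * (1 - \<tau>\<^sup>2) * (1 - s1 - s2\<^sup>2 * \<tau>\<^sup>2))"
    by simp
qed

end

section \<open>Cubics on lines and the splitting of a stream function\<close>

text \<open>Affine substitution preserves total degree three; the proof lists the new coefficients.
  With u2 = v2 = 0 this restricts to a line, and in general it passes to reference
  coordinates.\<close>

lemma cubic_affine_substitution:
  fixes u0 u1 u2 v0 v1 v2 :: real
  obtains q00 q10 q01 q20 q11 q02 q30 q21 q12 q03 where "\<And>X Y x y. x = u0 + u1 * X + u2 * Y \<Longrightarrow> y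
      = v0 + v1 * X + v2 * Y \<Longrightarrow>
    k1 * x + k2 * y + k3 * (x * y) + k4 * x\<^sup>2 + k5 * y\<^sup>2
    + (k6 * x^3 + k7 * (x\<^sup>2 * y) + k8 * (x * y\<^sup>2) + k9 * y^3)
        = bicubic q00 q10 q01 q20 q11 q02 q30 q21 q12 q03 X Y"
proof
  fix X Y x y :: real
  assume xy: "x = u0 + u1 * X + u2 * Y" "y = v0 + v1 * X + v2 * Y"
  show "k1 * x + k2 * y + k3 * (x * y) + k4 * x\<^sup>2 + k5 * y\<^sup>2
    + (k6 * x^3 + k7 * (x\<^sup>2 * y) + k8 * (x * y\<^sup>2) + k9 * y^3) = bicubic
     (k1 * u0 + k2 * v0 + k3 * u0 * v0 + k4 * u0 * u0 + k5 * v0 * v0 + k6 * u0 * u0 * u0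
         + k7 * u0 * u0 * v0 + k8 * u0 * v0 * v0 + k9 * v0 * v0 * v0)
     (k1 * u1 + k2 * v1 + k3 * u0 * v1 + k3 * u1 * v0 + 2 * k4 * u0 * u1 + 2 * k5 * v0 * v1
         + 3 * k6 * u0 * u0 * u1 + k7 * u0 * u0 * v1 + 2 * k7 * u0 * u1 * v0
         + 2 * k8 * u0 * v0 * v1 + k8 * u1 * v0 * v0 + 3 * k9 * v0 * v0 * v1)
     (k1 * u2 + k2 * v2 + k3 * u0 * v2 + k3 * u2 * v0 + 2 * k4 * u0 * u2 + 2 * k5 * v0 * v2
         + 3 * k6 * u0 * u0 * u2 + k7 * u0 * u0 * v2 + 2 * k7 * u0 * u2 * v0
         + 2 * k8 * u0 * v0 * v2 + k8 * u2 * v0 * v0 + 3 * k9 * v0 * v0 * v2)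
     (k3 * u1 * v1 + k4 * u1 * u1 + k5 * v1 * v1 + 3 * k6 * u0 * u1 * u1 + 2 * k7 * u0 * u1 * v1
         + k7 * u1 * u1 * v0 + k8 * u0 * v1 * v1 + 2 * k8 * u1 * v0 * v1 + 3 * k9 * v0 * v1 * v1)
     (k3 * u1 * v2 + k3 * u2 * v1 + 2 * k4 * u1 * u2 + 2 * k5 * v1 * v2 + 6 * k6 * u0 * u1 * u2
         + 2 * k7 * u0 * u1 * v2 + 2 * k7 * u0 * u2 * v1 + 2 * k7 * u1 * u2 * v0
         + 2 * k8 * u0 * v1 * v2 + 2 * k8 * u1 * v0 * v2 + 2 * k8 * u2 * v0 * v1
         + 6 * k9 * v0 * v1 * v2)
     (k3 * u2 * v2 + k4 * u2 * u2 + k5 * v2 * v2 + 3 * k6 * u0 * u2 * u2 + 2 * k7 * u0 * u2 * v2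
         + k7 * u2 * u2 * v0 + k8 * u0 * v2 * v2 + 2 * k8 * u2 * v0 * v2 + 3 * k9 * v0 * v2 * v2)
     (k6 * u1 * u1 * u1 + k7 * u1 * u1 * v1 + k8 * u1 * v1 * v1 + k9 * v1 * v1 * v1)
     (3 * k6 * u1 * u1 * u2 + k7 * u1 * u1 * v2 + 2 * k7 * u1 * u2 * v1 + 2 * k8 * u1 * v1 * v2
         + k8 * u2 * v1 * v1 + 3 * k9 * v1 * v1 * v2)
     (3 * k6 * u1 * u2 * u2 + 2 * k7 * u1 * u2 * v2 + k7 * u2 * u2 * v1 + k8 * u1 * v2 * v2
         + 2 * k8 * u2 * v1 * v2 + 3 * k9 * v1 * v2 * v2)
     (k6 * u2 * u2 * u2 + k7 * u2 * u2 * v2 + k8 * u2 * v2 * v2 + k9 * v2 * v2 * v2) X Y"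
    unfolding xy bicubic_def by (simp add: algebra_simps power2_eq_square power3_eq_cube)
qed

definition cubic_part :: "real^4^4 \<Rightarrow> real^2 \<Rightarrow> real" where
  "cubic_part c p =
     c$1$2 * p$1 + c$1$3 * p$2 + c$1$4 * (p$1 * p$2) + c$2$1 * (p$1)\<^sup>2 + c$2$2 * (p$2)\<^sup>2
   + (c$3$1 * (p$1)^3 + c$3$2 * ((p$1)\<^sup>2 * p$2) + c$3$3 * (p$1 * (p$2)\<^sup>2) + c$3$4 * (p$2)^3)"

definition bubble_factor :: "(4 \<Rightarrow> real^2) \<Rightarrow> real^4^4 \<Rightarrow> real^2 \<Rightarrow> real" where
  "bubble_factor V c p = c$4$1 + c$4$2 * p$1 + c$4$3 * p$2 + c$4$4 * (l13 V p * l24 V p)"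

lemma stream_split:
  "stream V c p = cubic_part c p + (c$2$3 * phi1 V p + c$2$4 * phi2 V p)
      + b0 V p * bubble_factor V c p"
  by (simp add: stream_def cubic_part_def bubble_factor_def algebra_simps)

lemma cubic_part_on_line:
  obtains k0 k1 k2 k3 where
    "\<And>s. cubic_part c (linepath P Q s) = k0 + k1 * (2 * s - 1) + k2 * (2 * s - 1)\<^sup>2 + k3 * (2 * s
        - 1)^3"
proof -
  obtain q00 q10 q01 q20 q11 q02 q30 q21 q12 q03 where
    q: "\<And>X Y x y. x = (P$1 + Q$1) / 2 + (Q$1 - P$1) / 2 * X + 0 * Y \<Longrightarrow> y = (P$2 + Q$2) / 2 + (Q$2
        - P$2) / 2 * X + 0 * Y \<Longrightarrow>
     c$1$2 * x + c$1$3 * y + c$1$4 * (x * y) + c$2$1 * x\<^sup>2 + c$2$2 * y\<^sup>2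
     + (c$3$1 * x^3 + c$3$2 * (x\<^sup>2 * y) + c$3$3 * (x * y\<^sup>2) + c$3$4 * y^3)
     = bicubic q00 q10 q01 q20 q11 q02 q30 q21 q12 q03 X Y"
    using cubic_affine_substitution[where ?k1.0 = "c$1$2" and ?k2.0 = "c$1$3" and ?k3.0 =
        "c$1$4" and ?k4.0 = "c$2$1"
       and ?k5.0 = "c$2$2" and ?k6.0 = "c$3$1" and ?k7.0 = "c$3$2" and ?k8.0 = "c$3$3" and ?k9.0 =
           "c$3$4"
       and ?u0.0 = "(P$1 + Q$1) / 2" and ?u1.0 = "(Q$1 - P$1) / 2" and ?u2.0 = 0
       and ?v0.0 = "(P$2 + Q$2) / 2" and ?v1.0 = "(Q$2 - P$2) / 2" and ?v2.0 = 0] by blast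
  have "cubic_part c (linepath P Q s) = q00 + q10 * (2 * s - 1) + q20 * (2 * s - 1)\<^sup>2
      + q30 * (2 * s - 1)^3" for s
    unfolding cubic_part_def
    by (subst q[where X = "2 * s - 1" and Y = 0])
       (simp_all add: linepath_def bicubic_def field_simps)
  then show thesis by (rule that)
qed

section \<open>Normal components and their first moments\<close>

context convex_quad
begin

lemma edge_nonzero: "V (i + 1) \<noteq> V i"
proof -
  have "\<forall>i. V (i + 1) \<noteq> V i"
    unfolding forall_4 four_arith using turns by (auto simp: cross2_def)
  then show ?thesis ..
qed

lemma edge_length_pos: "0 < edge_length V i"
  using edge_nonzero[of i] by (simp add: edge_length_def)

text \<open>Planar Lagrange identity, in which the product along the edge vanishes for a normal. The
  sign of \<open>\<nu>\<close> absorbs the free orientation of \<open>n i\<close>.\<close>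

lemma unit_normals_cross2:
  assumes "unit_normals V n"
  obtains \<nu> where "\<nu> \<noteq> 0" "\<And>v. v \<bullet> n i = \<nu> * cross2 v (V (i + 1) - V i)"
proof -
  define d where "d = V (i + 1) - V i"
  have d: "d \<bullet> d \<noteq> 0" using edge_nonzero[of i] by (simp add: d_def)
  have n: "norm (n i) = 1" "n i \<bullet> d = 0"
    using assms by (auto simp: unit_normals_def d_def)
  have "(v \<bullet> n i) * (d \<bullet> d) = (v \<bullet> d) * (n i \<bullet> d) + cross2 v d * cross2 (n i) d" for v
    by (simp add: inner_vec_def sum_2 cross2_def algebra_simps)
  then have eq: "v \<bullet> n i = (cross2 (n i) d / (d \<bullet> d)) * cross2 v d" for v
    using d n(2) by (simp add: field_simps)
  \<comment> \<open>Evaluating the formula at \<open>n i\<close> itself shows that the factor is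
    nonzero.\<close>
  have "n i \<bullet> n i \<noteq> 0"
    using n(1) by auto
  then have "cross2 (n i) d / (d \<bullet> d) \<noteq> 0"
    unfolding eq[of "n i"] by simp
  then show thesis using eq that unfolding d_def by blast
qed

lemma unit_tangents_scaleR:
  assumes "unit_tangents V t"
  obtains \<kappa> where "\<kappa> \<noteq> 0" "t i = \<kappa> *\<^sub>R (V (i + 1) - V i)"
proof -
  obtain c where c: "t i = c *\<^sub>R (V (i + 1) - V i)" and "norm (t i) = 1"
    using assms unfolding unit_tangents_def by blast
  then have "c \<noteq> 0" by auto
  with c show thesis using that by blast
qed

text \<open>Moving along \<open>Q - P\<close> does not change the cross product with it, so the
  position field contributes a constant.\<close>

lemma cross2_velocity_on_edge:
  "cross2 (velocity V c (linepath P Q s)) (Q - P)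
    = c$1$1 * cross2 P Q + cross2 (curl (stream V c) (linepath P Q s)) (Q - P)"
  by (simp add: velocity_def linepath_def cross2_def algebra_simps)

lemma b0_on_edge: "b0 V (linepath (V i) (V (i + 1)) s) = 0"
proof -
  have "\<forall>i. b0 V (linepath (V i) (V (i + 1)) s) = 0"
    unfolding forall_4 four_arith b0_def on_edge1 on_edge2 on_edge3 on_edge4 by simp
  then show ?thesis ..
qed

lemma phi_on_edge:
  obtains m0 m1 where "\<And>s. \<alpha> * phi1 V (linepath (V i) (V (i + 1)) s)
      + \<beta> * phi2 V (linepath (V i) (V (i + 1)) s)
    = (2 * s - 1) * (1 - (2 * s - 1)\<^sup>2) * (m0 + m1 * (2 * s - 1)\<^sup>2)"
proof -
  have ex: "\<exists>m0 m1. \<forall>s. k * (K * ((2 * s - 1) * (1 - (2 * s - 1)\<^sup>2) * (a + b * (2 * s - 1)\<^sup>2)))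
    = (2 * s - 1) * (1 - (2 * s - 1)\<^sup>2) * (m0 + m1 * (2 * s - 1)\<^sup>2)" for k K a b :: real
    by (intro exI[of _ "k * K * a"] exI[of _ "k * K * b"]) (simp add: algebra_simps)
  have "\<forall>i. \<exists>m0 m1. \<forall>s. \<alpha> * phi1 V (linepath (V i) (V (i + 1)) s)
      + \<beta> * phi2 V (linepath (V i) (V (i + 1)) s)
    = (2 * s - 1) * (1 - (2 * s - 1)\<^sup>2) * (m0 + m1 * (2 * s - 1)\<^sup>2)"
    unfolding forall_4 four_arith phi1_on_edges phi2_on_edges mult_zero_right add_0_left add_0_right
    \<comment> \<open>The two instances cover both signs of the quadratic term: plus for
      \<open>phi1\<close>, minus for \<open>phi2\<close>.\<close>
    by (intro conjI ex ex[where b = "- b" for b, unfolded mult_minus_left add_uminus_conv_diff])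
  then show thesis using that by blast
qed

text \<open>The derivative of the trace is computed explicitly and through the curl, and derivatives
  are unique. An odd quintic has an even derivative, so the only odd term comes from k2.\<close>

lemma curl_stream_on_edge:
  fixes k0 k1 k2 k3 m0 m1 :: real
  assumes cubic: "\<And>s. cubic_part c (linepath (V i) (V (i + 1)) s)
      = k0 + k1 * (2 * s - 1) + k2 * (2 * s - 1)\<^sup>2 + k3 * (2 * s - 1)^3"
    and phi: "\<And>s. c$2$3 * phi1 V (linepath (V i) (V (i + 1)) s)
        + c$2$4 * phi2 V (linepath (V i) (V (i + 1)) s)
      = (2 * s - 1) * (1 - (2 * s - 1)\<^sup>2) * (m0 + m1 * (2 * s - 1)\<^sup>2)"
  shows "cross2 (curl (stream V c) (linepath (V i) (V (i + 1)) s)) (V (i + 1) - V i)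
      = 2 * (k1 + m0 + 2 * k2 * (2 * s - 1) + 3 * (k3 + m1 - m0) * (2 * s - 1)\<^sup>2 - 5 * m1 * (2 * s
          - 1)^4)"
proof -
  have w: "stream V c (linepath (V i) (V (i + 1)) s) = k0 + k1 * (2 * s - 1) + k2 * (2 * s - 1)\<^sup>2
      + k3 * (2 * s - 1)^3
      + (2 * s - 1) * (1 - (2 * s - 1)\<^sup>2) * (m0 + m1 * (2 * s - 1)\<^sup>2)" for s
    unfolding stream_split cubic phi b0_on_edge by simp
  have "((\<lambda>s. k0 + k1 * (2 * s - 1) + k2 * (2 * s - 1)\<^sup>2 + k3 * (2 * s - 1)^3
      + (2 * s - 1) * (1 - (2 * s - 1)\<^sup>2) * (m0 + m1 * (2 * s - 1)\<^sup>2)) has_real_derivative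
      2 * (k1 + m0 + 2 * k2 * (2 * s - 1) + 3 * (k3 + m1 - m0) * (2 * s - 1)\<^sup>2 - 5 * m1 * (2 * s
          - 1)^4)) (at s)"
    by (rule derivative_eq_intros refl | simp)+ (simp add: algebra_simps power2_eq_square
        power3_eq_cube power4_eq_xxxx)
  then show ?thesis
    using has_derivative_along_line[OF real_polynomial_function_stream, of c "V i" "V (i + 1)" s]
    unfolding w by (rule DERIV_unique[rotated])
qed

text \<open>With \<tau> = 2 s - 1, the odd weight \<open>\<xi>\<close> selects the odd part 4 \<nu>
  k2 \<tau> of the normal component, and the difference of the end values sees only this part as
  well.\<close>

lemma normal_moment:
  assumes "unit_normals V n" and \<xi>: "\<xi> \<in> poly_space 1" "\<xi> (V i) = -1" "\<xi> (V (i + 1)) = 1"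
  shows "1 / edge_length V i * edge_integral V i (\<lambda>p. (velocity V c p \<bullet> n i) * \<xi> p)
     = 1/6 * ((velocity V c (V (i + 1)) - velocity V c (V i)) \<bullet> n i)"
proof -
  let ?lp = "linepath (V i) (V (i + 1))"
  obtain \<nu> where \<nu>: "\<And>v. v \<bullet> n i = \<nu> * cross2 v (V (i + 1) - V i)"
    using unit_normals_cross2[OF assms(1)] by metis
  obtain k0 k1 k2 k3 where k:
    "\<And>s. cubic_part c (?lp s) = k0 + k1 * (2 * s - 1) + k2 * (2 * s - 1)\<^sup>2 + k3 * (2 * s - 1)^3"
    using cubic_part_on_line[where c = c and P = "V i" and Q = "V (i + 1)"] by blast
  obtain m0 m1 where m:
    "\<And>s. c$2$3 * phi1 V (?lp s) + c$2$4 * phi2 V (?lp s)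
      = (2 * s - 1) * (1 - (2 * s - 1)\<^sup>2) * (m0 + m1 * (2 * s - 1)\<^sup>2)"
    using phi_on_edge[where \<alpha> = "c$2$3" and \<beta> = "c$2$4" and i = i] by blast
  note D = curl_stream_on_edge[OF k m]
  have v: "velocity V c (?lp s) \<bullet> n i = \<nu> * (c$1$1 * cross2 (V i) (V (i + 1)) +
      2 * (k1 + m0 + 2 * k2 * (2 * s - 1) + 3 * (k3 + m1 - m0) * (2 * s - 1)\<^sup>2 - 5 * m1 * (2 * s
          - 1)^4))" for s
    unfolding \<nu> cross2_velocity_on_edge D ..
  have \<xi>s: "\<xi> (?lp s) = 2 * s - 1" for s
  proof -
    obtain a b c where f: "\<xi> = (\<lambda>p. a + b * p$1 + c * p$2)" using \<xi>(1) unfolding poly_space_1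
        by blast
    have "\<xi> (?lp s) = (1 - s) * \<xi> (V i) + s * \<xi> (V (i + 1))"
      unfolding f by (simp add: linepath_def algebra_simps)
    then show ?thesis using \<xi> by simp
  qed
  have "1 / edge_length V i * edge_integral V i (\<lambda>p. (velocity V c p \<bullet> n i) * \<xi> p)
    = integral {0..1} (\<lambda>s. (velocity V c (?lp s) \<bullet> n i) * \<xi> (?lp s))"
    using edge_length_pos[of i] by (simp add: edge_integral_def)
  also have "\<dots> = 0 + (4 * \<nu> * k2) / 3 + 0 / 5"
    unfolding v \<xi>s
    by (rule integral_centred_quintic[where b = "\<nu> * (c$1$1 * cross2 (V i) (V (i + 1)) + 2 * (k1
        + m0))"
       and d = "6 * \<nu> * (k3 + m1 - m0)" and f = "- 10 * \<nu> * m1"])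
      (simp add: algebra_simps power2_eq_square eval_nat_numeral)
  also have "\<dots> = 1/6 * ((velocity V c (?lp 1) - velocity V c (?lp 0)) \<bullet> n i)"
    unfolding inner_diff_left v by (simp add: algebra_simps)
  finally show ?thesis by (simp add: linepath_def)
qed

end

section \<open>Unisolvence\<close>

context convex_quad
begin

text \<open>\<open>R\<close> is an antiderivative of the normal component: the position field
  contributes a constant and the curl a derivative.\<close>

lemma flux_eq:
  assumes "unit_normals V n" and flux: "edge_integral V i (\<lambda>p. velocity V c p \<bullet> n i) = 0"
  shows "c$1$1 * cross2 (V i) (V (i + 1)) + stream V c (V (i + 1)) - stream V c (V i) = 0"
proof -
  let ?lp = "linepath (V i) (V (i + 1))"
  obtain \<nu> where \<nu>: "\<nu> \<noteq> 0" "\<And>v. v \<bullet> n i = \<nu> * cross2 v (V (i + 1) - V i)"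
    using unit_normals_cross2[OF assms(1)] by metis
  define R where "R s = \<nu> * (c$1$1 * cross2 (V i) (V (i + 1)) * s + stream V c (?lp s))" for s
  have "(R has_vector_derivative (velocity V c (?lp s) \<bullet> n i)) (at s within {0..1})" for s
    unfolding R_def \<nu>(2) cross2_velocity_on_edge
        has_real_derivative_iff_has_vector_derivative[symmetric]
    using has_derivative_along_line[OF real_polynomial_function_stream, of c "V i" "V (i + 1)" s]
    by (auto intro!: derivative_eq_intros elim: DERIV_subset simp: has_field_derivative_at_within)
  then have "((\<lambda>s. velocity V c (?lp s) \<bullet> n i) has_integral R 1 - R 0) {0..1}"
    by (intro fundamental_theorem_of_calculus) auto
  then have "R 1 - R 0 = 0"
    using flux edge_length_pos[of i] by (simp add: edge_integral_def integral_unique)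
  then show ?thesis
    using \<nu>(1) by (simp add: R_def linepath_def flip: right_diff_distrib)
qed

text \<open>Summing around the boundary telescopes the stream values and leaves \<open>c$1$1\<close>
  times twice the area, as in the divergence theorem. After that each edge equates the values at its
  ends.\<close>

lemma no_flux:
  assumes "unit_normals V n" and "\<And>i. edge_integral V i (\<lambda>p. velocity V c p \<bullet> n i) = 0"
  shows "c$1$1 = 0" and "stream V c (V i) = stream V c (V 1)"
proof -
  note flux = flux_eq[OF assms]
  have area: "cross2 (V 1) (V 2) + cross2 (V 2) (V 3) + cross2 (V 3) (V 4) + cross2 (V 4) (V 1)
      = 8 * cross2 a1 a2"
    by (simp add: a1_def a2_def cross2_def algebra_simps)
  have "c$1$1 * (cross2 (V 1) (V 2) + cross2 (V 2) (V 3) + cross2 (V 3) (V 4)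
      + cross2 (V 4) (V 1)) = 0"
    using flux[of 1] flux[of 2] flux[of 3] flux[of 4] unfolding four_arith distrib_left by linarith
  then show c: "c$1$1 = 0"
    unfolding area using det_pos by simp
  have "\<forall>i. stream V c (V i) = stream V c (V 1)"
    using flux[of 1] flux[of 2] flux[of 3] flux[of 4] unfolding forall_4 four_arith c by simp
  then show "stream V c (V i) = stream V c (V 1)" ..
qed

text \<open>Hermite interpolation: the whole trace has value \<open>w0\<close> and slope zero at
  both ends. The cubic must therefore cancel the end slopes of the \<open>phi1\<close>,
  \<open>phi2\<close> part, where m0 + m1 \<tau>^2 equals m0 + m1.\<close>

lemma cubic_part_on_edge:
  fixes m0 m1 :: real
  assumes vert: "\<And>j. stream V c (V j) = w0" and grad: "\<And>j. curl (stream V c) (V j) = 0"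
    and phi: "\<And>s. c$2$3 * phi1 V (linepath (V i) (V (i + 1)) s)
        + c$2$4 * phi2 V (linepath (V i) (V (i + 1)) s)
      = (2 * s - 1) * (1 - (2 * s - 1)\<^sup>2) * (m0 + m1 * (2 * s - 1)\<^sup>2)"
  shows "cubic_part c (linepath (V i) (V (i + 1)) s) - w0 = - (m0 + m1) * ((2 * s - 1) - (2 * s
      - 1)^3)"
proof -
  let ?lp = "linepath (V i) (V (i + 1))"
  obtain k0 k1 k2 k3 where k:
    "\<And>s. cubic_part c (?lp s) = k0 + k1 * (2 * s - 1) + k2 * (2 * s - 1)\<^sup>2 + k3 * (2 * s - 1)^3"
    using cubic_part_on_line[where c = c and P = "V i" and Q = "V (i + 1)"] by blast
  have ends: "?lp 0 = V i" "?lp 1 = V (i + 1)" by (simp_all add: linepath_def)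
  have "stream V c (?lp s) = cubic_part c (?lp s) + (2 * s - 1) * (1 - (2 * s - 1)\<^sup>2) * (m0
      + m1 * (2 * s - 1)\<^sup>2)" for s
    unfolding stream_split phi b0_on_edge by simp
  from this[of 0] this[of 1] have v: "k0 - k1 + k2 - k3 = w0" "k0 + k1 + k2 + k3 = w0"
    unfolding k unfolding ends vert by simp_all
  have g: "k1 + m0 - 2 * k2 + 3 * (k3 + m1 - m0) - 5 * m1 = 0" "k1 + m0 + 2 * k2 + 3 * (k3 + m1
      - m0) - 5 * m1 = 0"
    using curl_stream_on_edge[OF k phi, of 0] curl_stream_on_edge[OF k phi, of 1]
    unfolding ends grad by (simp_all add: cross2_def)
  have "k1 + k3 = 0" "k2 = 0" "k0 = w0" "k1 + 3 * k3 = 2 * m0 + 2 * m1"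
    using v g by (simp_all add: algebra_simps)
  then have "k0 = w0" "k2 = 0" "k1 = - (m0 + m1)" "k3 = m0 + m1"
    by linarith+
  then show ?thesis
    unfolding k by (simp only:) (simp add: algebra_simps)
qed

text \<open>The cubic part has to compensate \<open>phi1\<close> on edges 2 and 4 and
  \<open>phi2\<close> on edges 1 and 3. One cubic can do so on both opposite edges only if the
  coefficients vanish.\<close>

lemma cubic_and_phi_vanish:
  assumes vert: "\<And>j. stream V c (V j) = w0" and grad: "\<And>j. curl (stream V c) (V j) = 0"
  shows "c$2$3 = 0 \<and> c$2$4 = 0 \<and> (\<forall>p. cubic_part c p = w0)"
proof -
  define \<alpha> \<beta> where "\<alpha> = c$2$3 / (4 * (1 - s1\<^sup>2))" and "\<beta> = c$2$4 / (4 * (1 - s2\<^sup>2))"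
  obtain q00 q10 q01 q20 q11 q02 q30 q21 q12 q03 where
    q: "\<And>X Y x y. x = ctr$1 + a1$1 * X + a2$1 * Y \<Longrightarrow> y = ctr$2 + a1$2 * X + a2$2 * Y \<Longrightarrow>
     c$1$2 * x + c$1$3 * y + c$1$4 * (x * y) + c$2$1 * x\<^sup>2 + c$2$2 * y\<^sup>2
     + (c$3$1 * x^3 + c$3$2 * (x\<^sup>2 * y) + c$3$3 * (x * y\<^sup>2) + c$3$4 * y^3)
     = bicubic q00 q10 q01 q20 q11 q02 q30 q21 q12 q03 X Y"
    using cubic_affine_substitution[where ?k1.0 = "c$1$2" and ?k2.0 = "c$1$3" and ?k3.0 =
        "c$1$4" and ?k4.0 = "c$2$1"
       and ?k5.0 = "c$2$2" and ?k6.0 = "c$3$1" and ?k7.0 = "c$3$2" and ?k8.0 = "c$3$3" and ?k9.0 =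
           "c$3$4"
       and ?u0.0 = "ctr$1" and ?u1.0 = "a1$1" and ?u2.0 = "a2$1"
       and ?v0.0 = "ctr$2" and ?v1.0 = "a1$2" and ?v2.0 = "a2$2"] by blast
  define Q where "Q = bicubic (q00 - w0) q10 q01 q20 q11 q02 q30 q21 q12 q03"
  have Q: "cubic_part c (ref X Y) - w0 = Q X Y" for X Y
    unfolding cubic_part_def Q_def
    by (subst q[where X = X and Y = Y]) (simp_all add: ref_def bicubic_def)
  have edge: "cubic_part c (linepath (V i) (V (i + 1)) ((\<tau> + 1) / 2)) - w0 = - (K * (A + B)) * (\<tau>
      - \<tau>^3)"
    if "\<And>s. c$2$3 * phi1 V (linepath (V i) (V (i + 1)) s) + c$2$4 * phi2 V (linepath (V i) (V (i
        + 1)) s)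
      = K * ((2 * s - 1) * (1 - (2 * s - 1)\<^sup>2) * (A + B * (2 * s - 1)\<^sup>2))" for i K A B and \<tau> :: real
    using cubic_part_on_edge[OF vert grad, where s = "(\<tau> + 1) / 2" and i = i and ?m0.0 =
        "K * A" and ?m1.0 = "K * B"] that
    by (simp add: field_simps)
  have half: "2 * ((\<tau> + 1) / 2) - 1 = \<tau>" for \<tau> :: real by (simp add: field_simps)
  \<comment> \<open>\<open>M1\<close> to \<open>M4\<close> are the values of - (m0 + m1) from
    \<open>cubic_part_on_edge\<close> on the four edges.\<close>
  define M1 where "M1 = - (\<beta> * ((1 - s1 + s2) * (1 - s1 - s2) * (1 - s1)\<^sup>2) * (1 + s1 - s2\<^sup>2))"
  define M2 where "M2 = \<alpha> * ((1 - s1 + s2) * (1 + s1 + s2) * (1 + s2)\<^sup>2) * (1 - s2 - s1\<^sup>2)"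
  define M3 where "M3 = - (\<beta> * ((1 + s1 + s2) * (1 + s1 - s2) * (1 + s1)\<^sup>2) * (1 - s1 - s2\<^sup>2))"
  define M4 where "M4 = \<alpha> * ((1 - s1 - s2) * (1 + s1 - s2) * (1 - s2)\<^sup>2) * (1 + s2 - s1\<^sup>2)"
  have E1: "Q ((1 - s1) * \<tau>) (- 1 - s2 * \<tau>) = M1 * (\<tau> - \<tau>^3)" for \<tau>
  proof -
    have "c$2$3 * phi1 V (linepath (V 1) (V (1 + 1)) s) + c$2$4 * phi2 V (linepath (V 1) (V (1
        + 1)) s)
      = \<beta> * ((1 - s1 + s2) * (1 - s1 - s2) * (1 - s1)\<^sup>2) * ((2 * s - 1) * (1 - (2 * s
          - 1)\<^sup>2) * ((1 + s1) + (- s2\<^sup>2) * (2 * s - 1)\<^sup>2))" for s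
      unfolding four_arith phi1_on_edges phi2_on_edges \<beta>_def by simp
    from edge[OF this, of \<tau>] show ?thesis
      unfolding four_arith linepath_ref Q half M1_def by (simp add: algebra_simps)
  qed
  have E2: "Q (1 + s1 * \<tau>) ((1 + s2) * \<tau>) = M2 * (\<tau> - \<tau>^3)" for \<tau>
  proof -
    have "c$2$3 * phi1 V (linepath (V 2) (V (2 + 1)) s) + c$2$4 * phi2 V (linepath (V 2) (V (2
        + 1)) s)
      = \<alpha> * ((1 - s1 + s2) * (1 + s1 + s2) * (1 + s2)\<^sup>2) * ((2 * s - 1) * (1 - (2 * s
          - 1)\<^sup>2) * ((- (1 - s2)) + s1\<^sup>2 * (2 * s - 1)\<^sup>2))" for s
      unfolding four_arith phi1_on_edges phi2_on_edges \<alpha>_def by simp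
    from edge[OF this, of \<tau>] show ?thesis
      unfolding four_arith linepath_ref Q half M2_def by (simp add: algebra_simps)
  qed
  have E3: "Q (- (1 + s1) * \<tau>) (1 - s2 * \<tau>) = M3 * (\<tau> - \<tau>^3)" for \<tau>
  proof -
    have "c$2$3 * phi1 V (linepath (V 3) (V (3 + 1)) s) + c$2$4 * phi2 V (linepath (V 3) (V (3
        + 1)) s)
      = \<beta> * ((1 + s1 + s2) * (1 + s1 - s2) * (1 + s1)\<^sup>2) * ((2 * s - 1) * (1 - (2 * s
          - 1)\<^sup>2) * ((1 - s1) + (- s2\<^sup>2) * (2 * s - 1)\<^sup>2))" for s
      unfolding four_arith phi1_on_edges phi2_on_edges \<beta>_def by simp
    from edge[OF this, of \<tau>] show ?thesis
      unfolding four_arith linepath_ref Q half M3_def by (simp add: algebra_simps)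
  qed
  have E4: "Q (- 1 + s1 * \<tau>) (- (1 - s2) * \<tau>) = M4 * (\<tau> - \<tau>^3)" for \<tau>
  proof -
    have "c$2$3 * phi1 V (linepath (V 4) (V (4 + 1)) s) + c$2$4 * phi2 V (linepath (V 4) (V (4
        + 1)) s)
      = \<alpha> * ((1 - s1 - s2) * (1 + s1 - s2) * (1 - s2)\<^sup>2) * ((2 * s - 1) * (1 - (2 * s
          - 1)\<^sup>2) * ((- (1 + s2)) + s1\<^sup>2 * (2 * s - 1)\<^sup>2))" for s
      unfolding four_arith phi1_on_edges phi2_on_edges \<alpha>_def by simp
    from edge[OF this, of \<tau>] show ?thesis
      unfolding four_arith linepath_ref Q half M4_def by (simp add: algebra_simps)
  qed
  \<comment> \<open>\<tau> = 0 is the midpoint and \<tau> = -1, 1 are the ends of an edge; \<tau> -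
    \<tau>^3 vanishes at all three.\<close>
  have mid: "Q 0 (-1) = 0" "Q 1 0 = 0" "Q 0 1 = 0" "Q (-1) 0 = 0"
    using E1[of 0] E2[of 0] E3[of 0] E4[of 0] by simp_all
  have vert: "Q (s1 - 1) (s2 - 1) = 0" "Q (1 - s1) (- 1 - s2) = 0" "Q (1 + s1) (1 + s2) = 0"
      "Q (- 1 - s1) (1 - s2) = 0"
    using E1[of "-1"] E1[of 1] E2[of 1] E3[of 1] by simp_all
  obtain a b where ab: "Q = (\<lambda>x y. a * y * (s2 * x + (1 - s1) * (y + 1)) * (s2 * x - (1 + s1) * (y
      - 1))
              + b * x * (s1 * y - (1 + s2) * (x - 1)) * (s1 * y + (1 - s2) * (x + 1)))"
    using cubic_vanishing_at_vertices_and_midpoints[OF s_bounds Q_def mid vert] by blast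
  have cancel: "x = y" if "k * x * 6 = k * y * 6" "0 < k" for k x y :: real
    using that by simp
  \<comment> \<open>Two expressions for \<open>Q\<close> along the line of an edge are compared at
    \<tau> = 2, where \<tau>^3 - \<tau> is the 6 in \<open>cancel\<close>.\<close>
  have a2: "a = \<alpha> * (1 + s2) * (1 - s2 - s1\<^sup>2)"
  proof (rule cancel[of "(1 - s1 + s2) * (1 + s1 + s2) * (1 + s2)"])
    have "Q (1 + s1 * \<tau>) ((1 + s2) * \<tau>) = - ((1 - s1 + s2) * (1 + s1 + s2) * (1
        + s2) * (a)) * (\<tau>^3 - \<tau>)" for \<tau>
      unfolding ab by (simp add: algebra_simps power3_eq_cube)
    from this[of 2] show "(1 - s1 + s2) * (1 + s1 + s2) * (1 + s2) * (a) * 6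
       = (1 - s1 + s2) * (1 + s1 + s2) * (1 + s2) * (\<alpha> * (1 + s2) * (1 - s2 - s1\<^sup>2)) * 6"
      unfolding E2 M2_def by (auto simp: power2_eq_square mult_ac)
  qed (use s_bounds s_abs_lt_1 in simp)
  have a4: "- a = \<alpha> * (1 - s2) * (1 + s2 - s1\<^sup>2)"
  proof (rule cancel[of "(1 - s1 - s2) * (1 + s1 - s2) * (1 - s2)"])
    have "Q (- 1 + s1 * \<tau>) (- (1 - s2) * \<tau>) = - ((1 - s1 - s2) * (1 + s1 - s2) * (1
        - s2) * (- a)) * (\<tau>^3 - \<tau>)" for \<tau>
      unfolding ab by (simp add: algebra_simps power3_eq_cube)
    from this[of 2] show "(1 - s1 - s2) * (1 + s1 - s2) * (1 - s2) * (- a) * 6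
       = (1 - s1 - s2) * (1 + s1 - s2) * (1 - s2) * (\<alpha> * (1 - s2) * (1 + s2 - s1\<^sup>2)) * 6"
      unfolding E4 M4_def by (auto simp: power2_eq_square mult_ac)
  qed (use s_bounds s_abs_lt_1 in simp)
  have b1: "b = - \<beta> * (1 - s1) * (1 + s1 - s2\<^sup>2)"
  proof (rule cancel[of "(1 - s1 + s2) * (1 - s1 - s2) * (1 - s1)"])
    have "Q ((1 - s1) * \<tau>) (- 1 - s2 * \<tau>) = - ((1 - s1 + s2) * (1 - s1 - s2) * (1
        - s1) * (b)) * (\<tau>^3 - \<tau>)" for \<tau>
      unfolding ab by (simp add: algebra_simps power3_eq_cube)
    from this[of 2] show "(1 - s1 + s2) * (1 - s1 - s2) * (1 - s1) * (b) * 6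
       = (1 - s1 + s2) * (1 - s1 - s2) * (1 - s1) * (- \<beta> * (1 - s1) * (1 + s1 - s2\<^sup>2)) * 6"
      unfolding E1 M1_def by (auto simp: power2_eq_square mult_ac)
  qed (use s_bounds s_abs_lt_1 in simp)
  have b3: "- b = - \<beta> * (1 + s1) * (1 - s1 - s2\<^sup>2)"
  proof (rule cancel[of "(1 + s1 + s2) * (1 + s1 - s2) * (1 + s1)"])
    have "Q (- (1 + s1) * \<tau>) (1 - s2 * \<tau>) = - ((1 + s1 + s2) * (1 + s1 - s2) * (1
        + s1) * (- b)) * (\<tau>^3 - \<tau>)" for \<tau>
      unfolding ab by (simp add: algebra_simps power3_eq_cube)
    from this[of 2] show "(1 + s1 + s2) * (1 + s1 - s2) * (1 + s1) * (- b) * 6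
       = (1 + s1 + s2) * (1 + s1 - s2) * (1 + s1) * (- \<beta> * (1 + s1) * (1 - s1 - s2\<^sup>2)) * 6"
      unfolding E3 M3_def by (auto simp: power2_eq_square mult_ac)
  qed (use s_bounds s_abs_lt_1 in simp)
  \<comment> \<open>Adding the formulas from opposite edges eliminates a and b and leaves these
    products up to a factor 2 or -2.\<close>
  have "\<alpha> * (1 - s1\<^sup>2 - s2\<^sup>2) = 0" "\<beta> * (1 - s1\<^sup>2 - s2\<^sup>2) = 0"
    using a2 a4 b1 b3 by (simp_all add: algebra_simps power2_eq_square)
  then have \<alpha>\<beta>: "\<alpha> = 0" "\<beta> = 0" using s_sq by simp_all
  moreover have "1 - s1\<^sup>2 \<noteq> 0" "1 - s2\<^sup>2 \<noteq> 0"
    using s_sq zero_le_power2[of s1] zero_le_power2[of s2] by linarith+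
  ultimately have "c$2$3 = 0" "c$2$4 = 0" by (simp_all add: \<alpha>_def \<beta>_def)
  moreover have "cubic_part c p = w0" for p
  proof -
    obtain X Y where p: "p = ref X Y" by (rule ref_surj)
    have "Q X Y = 0" unfolding ab using a2 b1 \<alpha>\<beta> by simp
    then show ?thesis using Q[of X Y] p by simp
  qed
  ultimately show ?thesis by blast
qed

end

section \<open>Bubbles and the tangential constraint\<close>

text \<open>The factor with p and q is the trace of \<open>b0\<close> stripped of one edge function,
  the last bracket that of the bubble factor. With \<tau> = 2 s - 1, the weights 5, 1, 4 are the
  proportions of the means 2/3, 2/15, 8/15 of 1 - \<tau>^2, \<tau>^2 (1 - \<tau>^2) and (1 -
  \<tau>^2)^2.\<close>

lemma integral_bubble_edge:
  fixes r :: "real \<Rightarrow> real"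
  assumes "\<And>s. r s = K * ((1 - (2 * s - 1)\<^sup>2) * (p + q * (2 * s - 1)) * (f0 + f1 * (2 * s - 1)
      + k * (1 - (2 * s - 1)\<^sup>2)))"
  shows "integral {0..1} r = 2 / 15 * K * (5 * p * f0 + q * f1 + 4 * p * k)"
proof -
  have "integral {0..1} r = K * (p * (f0 + k)) + K * (q * f1 - p * k - p * (f0 + k)) / 3
      + K * (p * k - q * f1) / 5"
    by (rule integral_centred_quintic[where b = "K * (p * f1 + q * (f0 + k))"
         and d = "K * (- q * k - p * f1 - q * (f0 + k))" and f = "K * (q * k)"])
       (simp add: assms algebra_simps power2_eq_square power3_eq_cube eval_nat_numeral)
  then show ?thesis by (simp add: field_simps)
qed

context convex_quad
begin

text \<open>The gradient of an affine function vanishing on the edge is normal to it, so the curl is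
  tangential.\<close>

lemma curl_l_edge:
  obtains K where "K \<noteq> 0" "\<And>p. curl (l_edge V i) p = K *\<^sub>R (V (i + 1) - V i)"
proof -
  define d m where "d = V (i + 1) - V i" and "m = cross2 d (edge_mid V (i + 2) - V i)"
  have "\<forall>i. cross2 (V (i + 1) - V i) (edge_mid V (i + 2) - V i) > 0"
  proof -
    have mid: "cross2 d (midpoint P Q - R) = (cross2 d (P - R) + cross2 d (Q - R)) / 2" for d P Q R
      by (simp add: midpoint_def cross2_def field_simps)
    show ?thesis
      unfolding forall_4 edge_mid_def four_arith mid using turns by (simp add: add_pos_pos)
  qed
  then have m: "m > 0" by (simp add: m_def d_def)
  have l: "l_edge V i = (\<lambda>p. cross2 d (p - V i) / m)"
    using m unfolding l_edge_def m_def d_def by (intro line_fun_eq) simp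
  have "((\<lambda>p. cross2 d (p - V i) / m) has_derivative (\<lambda>h. cross2 d h / m)) (at p)" for p
    unfolding cross2_def
    using m by (auto intro!: derivative_eq_intros bounded_linear.has_derivative[OF
        bounded_linear_vec_nth]
        simp: diff_divide_distrib)
  from partial_deriv_eq[OF this] have "curl (l_edge V i) p = (1 / m) *\<^sub>R d" for p
    unfolding l by (simp add: vec_eq_iff forall_2 cross2_def axis_def)
  then show thesis using m by (intro that[of "1 / m"]) (simp_all add: d_def)
qed

text \<open>On the edge the product rule keeps only \<open>u\<close> times the curl of
  \<open>l_edge V i\<close>, a nonzero constant vector along the edge; the tangential component is
  thus a fixed nonzero multiple of \<open>u\<close>.\<close>

lemma tangential_bubble:
  assumes t: "unit_tangents V t" and factor: "stream V c = (\<lambda>p. l_edge V i p * u p)" and u: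
      "real_polynomial_function u"
    and e: "c$1$1 = 0" and int0: "edge_integral V i (\<lambda>p. velocity V c p \<bullet> t i) = 0"
  shows "integral {0..1} (\<lambda>s. u (linepath (V i) (V (i + 1)) s)) = 0"
proof -
  let ?lp = "linepath (V i) (V (i + 1))"
  obtain \<kappa> where \<kappa>: "\<kappa> \<noteq> 0" "t i = \<kappa> *\<^sub>R (V (i + 1) - V i)"
    using unit_tangents_scaleR[OF t] by metis
  obtain K where K: "K \<noteq> 0" "\<And>p. curl (l_edge V i) p = K *\<^sub>R (V (i + 1) - V i)"
    using curl_l_edge by metis
  define C where "C = K * \<kappa> * ((V (i + 1) - V i) \<bullet> (V (i + 1) - V i))"
  have C: "C \<noteq> 0" using \<kappa> K edge_nonzero[of i] by (simp add: C_def)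
  have l0: "l_edge V i (?lp s) = 0" for s
  proof -
    have "\<forall>i. l_edge V i (linepath (V i) (V (i + 1)) s) = 0"
      unfolding forall_4 four_arith on_edge1 on_edge2 on_edge3 on_edge4 by simp
    then show ?thesis ..
  qed
  have "velocity V c (?lp s) \<bullet> t i = C * u (?lp s)" for s
    unfolding velocity_def factor curl_mult[OF
        real_polynomial_function_line_funs(1) u] l0 e K(2) \<kappa>(2) C_def
    by simp
  then show ?thesis
    using int0 edge_length_pos[of i] C by (simp add: edge_integral_def)
qed

text \<open>Along each edge the product of \<open>l13 V\<close> and \<open>l24 V\<close> is a
  multiple of 1 - \<tau>^2. Its sign alternates because a diagonal separates neighbouring edges,
  which produces the system of \<open>alternating_signs\<close>.\<close>

lemma bubble_vanish:
  assumes t: "unit_tangents V t" and stream: "\<And>p. stream V c p = b0 V p * bubble_factor V c p"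
    and e: "c$1$1 = 0" and int0: "\<And>i. edge_integral V i (\<lambda>p. velocity V c p \<bullet> t i) = 0"
  shows "c$4 = 0"
proof -
  \<comment> \<open>A, B, C describe the affine part of the bubble factor in reference coordinates;
    w is \<open>c$4$4\<close> divided by the denominators of \<open>l13 V\<close> and
    \<open>l24 V\<close>.\<close>
  define A B C w where "A = c$4$1 + c$4$2 * ctr$1 + c$4$3 * ctr$2" and "B = c$4$2 * a1$1
      + c$4$3 * a1$2"
    and "C = c$4$2 * a2$1 + c$4$3 * a2$2" and "w = c$4$4 / (4 * ((1 + s1 - s2) * (1 + s1 + s2)))"
  have g: "bubble_factor V c (ref X Y) = A + B * X + C * Y
      + c$4$4 * (l13 V (ref X Y) * l24 V (ref X Y))" for X Y
    unfolding bubble_factor_def A_def B_def C_def by (simp add: ref_def algebra_simps)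
  note poly = real_polynomial_function.intros(2-4) real_polynomial_function_line_funs
      real_polynomial_function_vec_nth
  have poly_g: "real_polynomial_function (bubble_factor V c)"
    unfolding bubble_factor_def[abs_def] by (intro poly)
  have prod: "a * x / (2 * k) * (b * y / (2 * k')) * (z / m)
      = a * b / (4 * (k * k' * m)) * (x * y * z)"
    for a b x y z k k' m :: real by (simp add: mult_ac)
  have quot: "c$4$4 * (a / (2 * (1 + s1 - s2)) * (b / (2 * (1 + s1 + s2)))) = w * (a * b)" for a b
    unfolding w_def using mult_quotients[of "c$4$4" a "1 + s1 - s2" b 1 "1 + s1 + s2" 1 1]
        by (simp add: mult_ac)
  \<comment> \<open>One computation serves all edges: L is \<open>b0 V\<close> without its factor
    \<open>l_edge V i\<close>, and k is the contribution of \<open>c$4$4\<close>.\<close>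
  have moment: "5 * p * f0 + q * f1 + 4 * p * k = 0"
    if L: "\<And>p. b0 V p = l_edge V i p * L p" "real_polynomial_function L"
      "\<And>s. L (linepath (V i) (V (i + 1)) s) = K * ((1 - (2 * s - 1)) * (1 + (2 * s - 1)) * (p
          + q * (2 * s - 1)))"
      "\<And>s. bubble_factor V c (linepath (V i) (V (i + 1)) s) = f0 + f1 * (2 * s - 1) + k * (1
          - (2 * s - 1)\<^sup>2)"
      and K: "K \<noteq> 0"
    for i L K p q f0 f1 k
  proof -
    have "stream V c = (\<lambda>p. l_edge V i p * (L p * bubble_factor V c p))"
      by (simp add: fun_eq_iff stream L(1))
    from tangential_bubble[OF t this real_polynomial_function.intros(4)[OF L(2) poly_g] e int0]
    have "integral {0..1} (\<lambda>s. L (linepath (V i) (V (i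
        + 1)) s) * bubble_factor V c (linepath (V i) (V (i + 1)) s)) = 0" .
    moreover have "integral {0..1} (\<lambda>s. L (linepath (V i) (V (i
        + 1)) s) * bubble_factor V c (linepath (V i) (V (i + 1)) s))
      = 2 / 15 * K * (5 * p * f0 + q * f1 + 4 * p * k)"
      unfolding L by (rule integral_bubble_edge) (simp add: algebra_simps power2_eq_square)
    ultimately show ?thesis using K by simp
  qed
  have e1: "5 * (1 + s1) * (A - C) + s2 * ((1 - s1) * B - s2 * C) + 4 * (1 + s1) * ((w * ((1 - s1
      + s2) * (1 - s1 - s2)))) = 0"
  proof (rule moment[of 1 "\<lambda>p. l_edge V 2 p * l_edge V 4 p * l_edge V 3 p"])
    show "b0 V p = l_edge V 1 p * (l_edge V 2 p * l_edge V 4 p * l_edge V 3 p)" for p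
      by (simp add: b0_def mult_ac)
    show "real_polynomial_function (\<lambda>p. l_edge V 2 p * l_edge V 4 p * l_edge V 3 p)"
      by (intro poly)
    show "l_edge V 2 (linepath (V 1) (V (1 + 1)) s) * l_edge V 4 (linepath (V 1) (V (1 + 1)) s)
        * l_edge V 3 (linepath (V 1) (V (1 + 1)) s)
      = (1 - s1 + s2) * (1 - s1 - s2) / (4 * ((1 + s2) * (1 - s2) * (1 + s1))) * ((1 - (2 * s
          - 1)) * (1 + (2 * s - 1)) * ((1 + s1) + s2 * (2 * s - 1)))" for s
      unfolding four_arith on_edge1 prod by simp
    show "bubble_factor V c (linepath (V 1) (V (1 + 1)) s)
      = A - C + ((1 - s1) * B - s2 * C) * (2 * s - 1) + (w * ((1 - s1 + s2) * (1 - s1 - s2))) * (1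
          - (2 * s - 1)\<^sup>2)" for s
      unfolding four_arith linepath_ref g unfolding linepath_ref[symmetric] on_edge1 quot
      by (simp add: algebra_simps power2_eq_square)
  qed (use s_bounds s_abs_lt_1 in simp)
  have e2: "5 * (1 - s2) * (A + B) + s1 * (s1 * B + (1 + s2) * C) + 4 * (1 - s2) * (- (w * ((1
      - s1 + s2) * (1 + s1 + s2)))) = 0"
  proof (rule moment[of 2 "\<lambda>p. l_edge V 3 p * l_edge V 1 p * l_edge V 4 p"])
    show "b0 V p = l_edge V 2 p * (l_edge V 3 p * l_edge V 1 p * l_edge V 4 p)" for p
      by (simp add: b0_def mult_ac)
    show "real_polynomial_function (\<lambda>p. l_edge V 3 p * l_edge V 1 p * l_edge V 4 p)"
      by (intro poly)
    show "l_edge V 3 (linepath (V 2) (V (2 + 1)) s) * l_edge V 1 (linepath (V 2) (V (2 + 1)) s)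
        * l_edge V 4 (linepath (V 2) (V (2 + 1)) s)
      = (1 + s1 + s2) * (1 - s1 + s2) / (4 * ((1 + s1) * (1 - s1) * (1 - s2))) * ((1 - (2 * s
          - 1)) * (1 + (2 * s - 1)) * ((1 - s2) + s1 * (2 * s - 1)))" for s
      unfolding four_arith on_edge2 prod by simp
    show "bubble_factor V c (linepath (V 2) (V (2 + 1)) s)
      = A + B + (s1 * B + (1 + s2) * C) * (2 * s - 1) + - (w * ((1 - s1 + s2) * (1 + s1
          + s2))) * (1 - (2 * s - 1)\<^sup>2)" for s
      unfolding four_arith linepath_ref g unfolding linepath_ref[symmetric] on_edge2 quot
      by (simp add: algebra_simps power2_eq_square)
  qed (use s_bounds s_abs_lt_1 in simp)
  have e3: "5 * (1 - s1) * (A + C) + - s2 * (- (1 + s1) * B - s2 * C) + 4 * (1 - s1) * ((w * ((1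
      + s1 - s2) * (1 + s1 + s2)))) = 0"
  proof (rule moment[of 3 "\<lambda>p. l_edge V 4 p * l_edge V 2 p * l_edge V 1 p"])
    show "b0 V p = l_edge V 3 p * (l_edge V 4 p * l_edge V 2 p * l_edge V 1 p)" for p
      by (simp add: b0_def mult_ac)
    show "real_polynomial_function (\<lambda>p. l_edge V 4 p * l_edge V 2 p * l_edge V 1 p)"
      by (intro poly)
    show "l_edge V 4 (linepath (V 3) (V (3 + 1)) s) * l_edge V 2 (linepath (V 3) (V (3 + 1)) s)
        * l_edge V 1 (linepath (V 3) (V (3 + 1)) s)
      = (1 + s1 - s2) * (1 + s1 + s2) / (4 * ((1 - s2) * (1 + s2) * (1 - s1))) * ((1 - (2 * s
          - 1)) * (1 + (2 * s - 1)) * ((1 - s1) + - s2 * (2 * s - 1)))" for s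
      unfolding four_arith on_edge3 prod by simp
    show "bubble_factor V c (linepath (V 3) (V (3 + 1)) s)
      = A + C + (- (1 + s1) * B - s2 * C) * (2 * s - 1) + (w * ((1 + s1 - s2) * (1 + s1
          + s2))) * (1 - (2 * s - 1)\<^sup>2)" for s
      unfolding four_arith linepath_ref g unfolding linepath_ref[symmetric] on_edge3 quot
      by (simp add: algebra_simps power2_eq_square)
  qed (use s_bounds s_abs_lt_1 in simp)
  have e4: "5 * (1 + s2) * (A - B) + - s1 * (s1 * B - (1 - s2) * C) + 4 * (1 + s2) * (- (w * ((1
      + s1 - s2) * (1 - s1 - s2)))) = 0"
  proof (rule moment[of 4 "\<lambda>p. l_edge V 1 p * l_edge V 3 p * l_edge V 2 p"])
    show "b0 V p = l_edge V 4 p * (l_edge V 1 p * l_edge V 3 p * l_edge V 2 p)" for p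
      by (simp add: b0_def mult_ac)
    show "real_polynomial_function (\<lambda>p. l_edge V 1 p * l_edge V 3 p * l_edge V 2 p)"
      by (intro poly)
    show "l_edge V 1 (linepath (V 4) (V (4 + 1)) s) * l_edge V 3 (linepath (V 4) (V (4 + 1)) s)
        * l_edge V 2 (linepath (V 4) (V (4 + 1)) s)
      = (1 - s1 - s2) * (1 + s1 - s2) / (4 * ((1 - s1) * (1 + s1) * (1 + s2))) * ((1 - (2 * s
          - 1)) * (1 + (2 * s - 1)) * ((1 + s2) + - s1 * (2 * s - 1)))" for s
      unfolding four_arith on_edge4 prod by simp
    show "bubble_factor V c (linepath (V 4) (V (4 + 1)) s)
      = A - B + (s1 * B - (1 - s2) * C) * (2 * s - 1) + - (w * ((1 + s1 - s2) * (1 - s1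
          - s2))) * (1 - (2 * s - 1)\<^sup>2)" for s
      unfolding four_arith linepath_ref g unfolding linepath_ref[symmetric] on_edge4 quot
      by (simp add: algebra_simps power2_eq_square)
  qed (use s_bounds s_abs_lt_1 in simp)
  have zero: "A = 0 \<and> B = 0 \<and> C = 0 \<and> w = 0"
  proof (rule alternating_signs[OF s_bounds])
    show "5 * (1 + s1) * (A - C) + s2 * ((1 - s1) * B - s2 * C) = - (4 * (1 + s1) * ((1 - s1
        + s2) * (1 - s1 - s2))) * w"
      using e1 by (simp add: algebra_simps)
    show "5 * (1 - s2) * (A + B) + s1 * (s1 * B + (1 + s2) * C) = (4 * (1 - s2) * ((1 - s1
        + s2) * (1 + s1 + s2))) * w"
      using e2 by (simp add: algebra_simps)
    show "5 * (1 - s1) * (A + C) + s2 * ((1 + s1) * B + s2 * C) = - (4 * (1 - s1) * ((1 + s1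
        - s2) * (1 + s1 + s2))) * w"
      using e3 by (simp add: algebra_simps)
    show "5 * (1 + s2) * (A - B) - s1 * (s1 * B - (1 - s2) * C) = (4 * (1 + s2) * ((1 + s1
        - s2) * (1 - s1 - s2))) * w"
      using e4 by (simp add: algebra_simps)
  qed (use s_bounds s_abs_lt_1 in simp_all)
  then have c44: "c$4$4 = 0"
    using s_bounds by (simp add: w_def)
  \<comment> \<open>B and C are the derivatives of the affine part along \<open>a1\<close> and
    \<open>a2\<close>; Cramer's rule recovers its gradient.\<close>
  have "c$4$2 * cross2 a1 a2 = B * a2$2 - C * a1$2" "c$4$3 * cross2 a1 a2 = C * a1$1 - B * a2$1"
    by (simp_all add: B_def C_def cross2_def algebra_simps)
  then have "c$4$2 = 0" "c$4$3 = 0" using zero det_pos by simp_all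
  with zero c44 show ?thesis
    by (simp add: vec_eq_iff forall_4 A_def)
qed


section \<open>Dimension count and the three claims\<close>

text \<open>Additivity needs integrable integrands, which continuity of velocities provides. The
  fixed vector a stands for a normal or a tangent.\<close>

lemma linear_edge_integral_velocity: "linear (\<lambda>c. edge_integral V i (\<lambda>p. velocity V c p \<bullet> a))"
proof -
  have int: "(\<lambda>s. velocity V c (linepath (V i) (V (i + 1)) s) \<bullet> a) integrable_on {0..1}" for c
    by (intro integrable_continuous_real continuous_intros continuous_on_compose2[OF
        continuous_on_velocity])
       auto
  have lin: "velocity V (c + d) p = velocity V c p + velocity V d p" "velocity V (k *\<^sub>R c) p
      = k *\<^sub>R velocity V c p" for c d k p
    using linear_add[OF linear_velocity] linear_cmul[OF linear_velocity]
        by (simp_all add: scaleR_fun_def)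
  show ?thesis
    by (rule linearI)
       (simp_all add: edge_integral_def lin inner_add_left integral_add[OF int int] distrib_left)
qed

lemma velocity_unisolvent:
  assumes "unit_normals V n" "unit_tangents V t"
    and flux: "\<And>i. edge_integral V i (\<lambda>p. velocity V c p \<bullet> n i) = 0"
    and vert: "\<And>i. velocity V c (V i) = 0"
    and tang: "\<And>i. edge_integral V i (\<lambda>p. velocity V c p \<bullet> t i) = 0"
  shows "c = 0"
proof -
  have e: "c$1$1 = 0" and w: "stream V c (V i) = stream V c (V 1)" for i
    using no_flux[OF assms(1) flux] by blast+
  have grad: "curl (stream V c) (V i) = 0" for i
    using vert[of i] e by (simp add: velocity_def)
  have phi: "c$2$3 = 0" "c$2$4 = 0" and cub: "cubic_part c p = stream V c (V 1)" for p
    using cubic_and_phi_vanish[OF w grad] by blast+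
  have z: "c$1$2 = 0 \<and> c$1$3 = 0 \<and> c$1$4 = 0 \<and> c$2$1 = 0 \<and> c$2$2 = 0
    \<and> c$3$1 = 0 \<and> c$3$2 = 0 \<and> c$3$3 = 0 \<and> c$3$4 = 0"
    using cub[of "vector [x, y]" for x y, unfolded cubic_part_def vector_2] by (rule cubic_eq_const)
  then have "stream V c p = b0 V p * bubble_factor V c p" for p
    unfolding stream_split phi cubic_part_def by simp
  from bubble_vanish[OF assms(2) this e tang] have "c$4 = 0" .
  with z e phi show ?thesis
    by (simp add: vec_eq_iff forall_4)
qed

text \<open>Bundles the four constraints into one map to \<open>real^4\<close>, the form that
  \<open>dim_kernel_unisolvent\<close> expects of \<open>G\<close>.\<close>

lemma VK_eq: "VK V t = {v \<in> range (velocity V).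
   (\<chi> i. 1 / edge_length V i * edge_integral V i (\<lambda>p. v p \<bullet> t i)
         - 1/2 * ((v (V i) + v (V (i + 1))) \<bullet> t i)) = (0 :: real^4)}"
  unfolding VK_def range_velocity by (simp add: vec_eq_iff)

text \<open>The count is 16 = 12 + 4: four fluxes and four plane vectors form the target of
  \<open>F\<close>, the four constraints that of \<open>G\<close>.\<close>

lemma VK_unisolvent:
  assumes n: "unit_normals V n" and t: "unit_tangents V t"
  shows "dim (VK V t) = 12"
    and "v \<in> VK V t \<Longrightarrow> (\<And>i. edge_integral V i (\<lambda>p. v p \<bullet> n i) = 0) \<Longrightarrow> (\<And>i. v (V i) = 0) \<Longrightarrow> v = 0"
proof -
  define F :: "(real^2 \<Rightarrow> real^2) \<Rightarrow> (real^4) \<times> ((real^2)^4)" where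
    "F v = (\<chi> i. edge_integral V i (\<lambda>p. v p \<bullet> n i), \<chi> i. v (V i))" for v
  define G :: "(real^2 \<Rightarrow> real^2) \<Rightarrow> real^4" where
    "G v = (\<chi> i. 1 / edge_length V i * edge_integral V i (\<lambda>p. v p \<bullet> t i)
         - 1/2 * ((v (V i) + v (V (i + 1))) \<bullet> t i))" for v
  have lin: "velocity V (c + d) p = velocity V c p + velocity V d p" "velocity V (k *\<^sub>R c) p
      = k *\<^sub>R velocity V c p" for c d k p
    using linear_add[OF linear_velocity] linear_cmul[OF linear_velocity]
        by (simp_all add: scaleR_fun_def)
  note int_lin
      = linear_add[OF linear_edge_integral_velocity] linear_cmul[OF linear_edge_integral_velocity]
  have linF: "linear (\<lambda>c. F (velocity V c))"
    by (rule linearI) (simp_all add: F_def vec_eq_iff int_lin, simp_all add: lin)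
  have linG: "linear (\<lambda>c. G (velocity V c))"
    by (rule linearI) (simp_all add: G_def vec_eq_iff int_lin, simp_all add: lin algebra_simps
        inner_add_left add_divide_distrib)
  have uni: "c = 0" if "F (velocity V c) = 0" "G (velocity V c) = 0" for c
  proof -
    have flux: "edge_integral V i (\<lambda>p. velocity V c p \<bullet> n i) = 0" and vert: "velocity V c (V i)
        = 0" for i
      using that(1) by (simp_all add: F_def zero_prod_def vec_eq_iff)
    \<comment> \<open>With zero vertex values the constraint loses its right-hand side.\<close>
    have "edge_integral V i (\<lambda>p. velocity V c p \<bullet> t i) = 0" for i
    proof -
      have "G (velocity V c) $ i = 0" using that(2) by simp
      then show ?thesis using edge_length_pos[of i] by (auto simp: G_def vert)
    qed
    with flux vert show ?thesis using velocity_unisolvent[OF n t] by blast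
  qed
  have VK: "VK V t = {v \<in> range (velocity V). G v = 0}"
    unfolding VK_eq G_def ..
  show "dim (VK V t) = 12"
    unfolding VK using dim_kernel_unisolvent[where \<Phi> = "velocity V" and F = F and G
        = G, OF linear_velocity linF linG uni]
    by simp
  show "v = 0" if v: "v \<in> VK V t" and "\<And>i. edge_integral V i (\<lambda>p. v p \<bullet> n i) = 0" "\<And>i. v (V i) = 0"
  proof -
    obtain c where c: "v = velocity V c" "G v = 0" using v unfolding VK by blast
    have "F v = 0" using that(2,3) by (simp add: F_def zero_prod_def vec_eq_iff)
    then have "c = 0" using uni c by blast
    then show ?thesis using c(1) linear_0[OF linear_velocity] by simp
  qed
qed

text \<open>The constraint is the trapezoidal rule for the tangential component, which is exact for
  affine integrands.\<close>

lemma vec_poly_space_subset_VK: "vec_poly_space 1 \<subseteq> VK V t"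
proof
  fix v assume v: "v \<in> vec_poly_space 1"
  then obtain a b c a' b' c' where f: "v = (\<lambda>p. vector [a + b * p$1 + c * p$2, a' + b' * p$1
      + c' * p$2])"
    unfolding vec_poly_space_1_iff by blast
  have "1 / edge_length V i * edge_integral V i (\<lambda>p. v p \<bullet> t i) = 1/2 * ((v (V i) + v (V (i
      + 1))) \<bullet> t i)" for i
  proof -
    let ?\<alpha> = "v (V i) \<bullet> t i" and ?\<beta> = "v (V (i + 1)) \<bullet> t i"
    have v_line: "v (linepath (V i) (V (i + 1)) s) = (1 - s) *\<^sub>R v (V i) + s *\<^sub>R v (V (i + 1))"
        for s
      unfolding f by (simp add: vec_eq_iff forall_2 linepath_def algebra_simps)
    have "integral {0..1} (\<lambda>s. v (linepath (V i) (V (i + 1)) s) \<bullet> t i) = (?\<alpha> + ?\<beta>) / 2 + 0 / 3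
        + 0 / 5"
      by (intro integral_centred_quintic[where b = "(?\<beta> - ?\<alpha>) / 2" and d = 0 and f = 0])
         (simp only: v_line inner_add_left inner_scaleR_left, simp add: field_simps)
    then show ?thesis
      using edge_length_pos[of i] by (simp add: edge_integral_def inner_add_left)
  qed
  then show "v \<in> VK V t"
    unfolding VK_eq using vec_poly_space_in_range[OF v] by (simp add: vec_eq_iff)
qed

end

text \<open>\<open>of_nat\<close> maps 1 to 4 onto the whole index type, 4 becoming 0. Numbers 5 to
  8 carry the first components at the vertices and 9 to 12 the second.\<close>

lemma dof_zeroD:
  assumes "\<forall>j \<in> {1..12}. dof V n j v = 0"
  shows "edge_integral V i (\<lambda>p. v p \<bullet> n i) = 0" and "v (V i) = 0"
proof -
  have d: "dof V n j v = 0" if "j \<in> {1..12}" for j using assms that by blast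
  have "\<forall>i. edge_integral V i (\<lambda>p. v p \<bullet> n i) = 0"
    using d[of 1] d[of 2] d[of 3] d[of 4] unfolding forall_4 by (simp add: dof_def)
  then show "edge_integral V i (\<lambda>p. v p \<bullet> n i) = 0" ..
  have "\<forall>i. v (V i) = 0"
    using d[of 5] d[of 6] d[of 7] d[of 8] d[of 9] d[of 10] d[of 11] d[of 12]
    unfolding forall_4 by (simp add: dof_def vec_eq_iff forall_2)
  then show "v (V i) = 0" ..
qed

theorem theorem3p4:
  fixes V n t :: "4 \<Rightarrow> real^2"
  assumes "convex_quadrilateral V"
    and "unit_normals V n"
    and "unit_tangents V t"
  shows "(dim (VK V t) = 12 \<and>
          (\<forall>v \<in> VK V t. (\<forall>j \<in> {1..12}. dof V n j v = 0) \<longrightarrow> v = 0)) \<and>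
         (\<forall>v \<in> VK V t. \<forall>i. \<forall>\<xi> \<in> poly_space 1.
            \<xi> (V i) = -1 \<and> \<xi> (V (i + 1)) = 1 \<longrightarrow>
            1 / edge_length V i * edge_integral V i (\<lambda>p. (v p \<bullet> n i) * \<xi> p)
              = 1/6 * ((v (V (i + 1)) - v (V i)) \<bullet> n i)) \<and>
         vec_poly_space 1 \<subseteq> VK V t"
proof -
  interpret convex_quad V by unfold_locales (rule assms(1))
  show ?thesis
  proof (intro conjI ballI allI impI)
    show "dim (VK V t) = 12" by (rule VK_unisolvent[OF assms(2,3)])
    show "v = 0" if "v \<in> VK V t" "\<forall>j \<in> {1..12}. dof V n j v = 0" for v
      using VK_unisolvent(2)[OF assms(2,3) that(1)] dof_zeroD[OF that(2)] by blast
    show "1 / edge_length V i * edge_integral V i (\<lambda>p. (v p \<bullet> n i) * \<xi> p)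
              = 1/6 * ((v (V (i + 1)) - v (V i)) \<bullet> n i)"
      if "v \<in> VK V t" "\<xi> \<in> poly_space 1" "\<xi> (V i) = -1 \<and> \<xi> (V (i + 1)) = 1" for v i \<xi>
      using that normal_moment[OF assms(2)] unfolding VK_eq by auto
    show "vec_poly_space 1 \<subseteq> VK V t" by (rule vec_poly_space_subset_VK)
  qed
qed

end
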